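(* Let $\widetilde{H}$ be the affine Hecke algebra of type $G_2$. Assume $q^2\neq\pm1$, let $r\in\mathbb{C}^\times$ be a third root of $q^2$ (i.e. $r^3=q^2$) not equal to $q^{\pm2}$ or $\pm q^{\pm1}$, and let $t=t_{r,1}$. Put $t'=s_1t$ (so that $t'(X^{\alpha_2})=q^2$) and $w_0=s_1s_2s_1s_2s_1s_2$. Let $\mathbb{C}v_{t'}$ and $\mathbb{C}v_{w_0t'}$ be the $1$-dimensional $\widetilde{H}_{\{2\}}$-modules given by $T_2v_{t'}=qv_{t'}$, $X^\lambda v_{t'}=t'(X^\lambda)v_{t'}$, and $T_2v_{w_0t'}=-q^{-1}v_{w_0t'}$, $X^\lambda v_{w_0t'}=(w_0t')(X^\lambda)v_{w_0t'}$, and let $M=\widetilde{H}\otimes_{\widetilde{H}_{\{2\}}}\mathbb{C}v_{t'}$ and $N=\widetilde{H}\otimes_{\widetilde{H}_{\{2\}}}\mathbb{C}v_{w_0t'}$. Then $M$ and $N$ are irreducible.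
   Context: The type $G_2$ root system has simple roots $\alpha_1,\alpha_2$ with $\langle\alpha_1,\alpha_2^\vee\rangle=-1$, $\langle\alpha_2,\alpha_1^\vee\rangle=-3$; $s_i\lambda=\lambda-\langle\lambda,\alpha_i^\vee\rangle\alpha_i$, and $W_0=\langle s_1,s_2\rangle$. $P=\mathbb{Z}\alpha_1+\mathbb{Z}\alpha_2$ is the weight lattice; $X=\{X^\lambda\mid\lambda\in P\}$, $X^\lambda X^\mu=X^{\lambda+\mu}$. For $q\in\mathbb{C}^\times$, $\widetilde{H}$ is the $\mathbb{C}$-algebra generated by $T_1,T_2$ and $X^\lambda$ ($\lambda\in P$), with the group algebra $\mathbb{C}[X]$ a subalgebra, subject to $T_i^2=(q-q^{-1})T_i+1$, $T_1T_2T_1T_2T_1T_2=T_2T_1T_2T_1T_2T_1$, and $X^\lambda T_i=T_iX^{s_i\lambda}+(q-q^{-1})\frac{X^\lambda-X^{s_i\lambda}}{1-X^{-\alpha_i}}$. $\widetilde{H}_{\{i\}}$ is the subalgebra generated by $T_i$ and $\mathbb{C}[X]$. Weights are elements of $T=\mathrm{Hom}(X,\mathbb{C}^\times)$, with $W_0$-action $(wt)(X^\lambda)=t(X^{w^{-1}\lambda})$; $t_{z,w}\in T$ is given by $t_{z,w}(X^{\alpha_1})=z$, $t_{z,w}(X^{\alpha_2})=w$. *)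

theory Defs
  imports Complex_Main "HOL-Library.Product_Plus" "HOL-Library.Poly_Mapping" "HOL-Algebra.Algebra"
begin

section \<open>The root system of type $G_2$\<close>

datatype node = N1 | N2

text \<open>The pair \<open>(a, b)\<close> stands for the element \<open>a \<alpha>\<^sub>1 + b \<alpha>\<^sub>2\<close> of the weight lattice.\<close>

type_synonym lattice = "int \<times> int"

fun sroot :: "node \<Rightarrow> lattice" where
  "sroot N1 = (1, 0)"
| "sroot N2 = (0, 1)"

text \<open>\<open>pairing \<lambda> i\<close> is \<open>\<langle>\<lambda>, \<alpha>\<^sub>i\<^sup>\<or>\<rangle>\<close>.\<close>

fun pairing :: "lattice \<Rightarrow> node \<Rightarrow> int" where
  "pairing (a, b) N1 = 2 * a - 3 * b"
| "pairing (a, b) N2 = - a + 2 * b"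

lemma pairing_roots:
  "pairing (sroot N1) N1 = 2" "pairing (sroot N2) N2 = 2"
  "pairing (sroot N1) N2 = -1" "pairing (sroot N2) N1 = -3"
  by simp_all

definition srefl :: "node \<Rightarrow> lattice \<Rightarrow> lattice" where
  "srefl i l = (fst l - pairing l i * fst (sroot i), snd l - pairing l i * snd (sroot i))"

definition w0 :: "lattice \<Rightarrow> lattice" where
  "w0 = srefl N1 \<circ> srefl N2 \<circ> srefl N1 \<circ> srefl N2 \<circ> srefl N1 \<circ> srefl N2"

section \<open>Weights\<close>

text \<open>An element \<open>t\<close> of \<open>Hom(X, \<complex>\<^sup>\<times>)\<close> is given by the function \<open>\<lambda> \<mapsto> t(X\<^sup>\<lambda>)\<close> on the lattice.\<close>

definition weights :: "(lattice \<Rightarrow> complex) set" where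
  "weights = {t. (\<forall>l. t l \<noteq> 0) \<and> (\<forall>l m. t (l + m) = t l * t m)}"

definition wt :: "complex \<Rightarrow> complex \<Rightarrow> lattice \<Rightarrow> complex" where
  "wt z w l = z powi (fst l) * w powi (snd l)"

definition weight_act :: "(lattice \<Rightarrow> lattice) \<Rightarrow> (lattice \<Rightarrow> complex) \<Rightarrow> lattice \<Rightarrow> complex" where
  "weight_act w t = (\<lambda>l. t (inv_into UNIV w l))"

lemma wt_in_weights: "z \<noteq> 0 \<Longrightarrow> w \<noteq> 0 \<Longrightarrow> wt z w \<in> weights"
  by (simp add: weights_def wt_def power_int_add)

lemma wt_roots [simp]: "wt z w (sroot N1) = z" "wt z w (sroot N2) = w"
  by (simp_all add: wt_def)

lemma srefl_invol [simp]: "srefl i (srefl i l) = l"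
  by (cases l; cases i) (simp_all add: srefl_def)

lemma inv_srefl [simp]: "inv_into UNIV (srefl i) = srefl i"
  by (rule Hilbert_Choice.inv_equality) simp_all

lemma w0_eq_uminus: "w0 l = - l"
  by (cases l) (simp add: w0_def srefl_def)

lemma weight_act_s1_wt: "weight_act (srefl N1) (wt r 1) (sroot N2) = r ^ 3"
  by (simp add: weight_act_def srefl_def wt_def)

section \<open>The affine Hecke algebra\<close>

datatype gen = GT node | GX lattice

text \<open>Words in the generators form the free monoid. It is written additively, so that finitely
  supported functions on words, with the convolution product of
  \<^theory>\<open>HOL-Library.Poly_Mapping\<close>, form the free associative unital algebra.\<close>

datatype word = Word (letters: "gen list")

instantiation word :: monoid_add
begin

definition "0 = Word []"
definition "v + w = Word (letters v @ letters w)"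

instance
  by standard (simp_all add: zero_word_def plus_word_def)

end

type_synonym falg = "word \<Rightarrow>\<^sub>0 complex"

definition FC :: "complex \<Rightarrow> falg" where "FC c = Poly_Mapping.single 0 c"
definition FT :: "node \<Rightarrow> falg" where "FT i = Poly_Mapping.single (Word [GT i]) 1"
definition FX :: "lattice \<Rightarrow> falg" where "FX l = Poly_Mapping.single (Word [GX l]) 1"

text \<open>The linear extension of \<open>X\<^sup>\<lambda> \<mapsto> FX \<lambda>\<close>; its argument is an element of the group algebra
  of the lattice, whose product is again convolution.\<close>

definition FX_lin :: "(lattice \<Rightarrow>\<^sub>0 complex) \<Rightarrow> falg" where
  "FX_lin f = (\<Sum>l\<in>Poly_Mapping.keys f. FC (Poly_Mapping.lookup f l) * FX l)"

definition eX :: "lattice \<Rightarrow> (lattice \<Rightarrow>\<^sub>0 complex)" where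
  "eX l = Poly_Mapping.single l 1"

lemma eX_mult: "eX l * eX m = eX (l + m)"
  by (simp add: eX_def mult_single)

lemma fraction_exists: "\<exists>f. f * (1 - eX (- sroot i)) = eX l - eX (srefl i l)"
proof -
  define mul where "mul k = (k * fst (sroot i), k * snd (sroot i))" for k :: int
  have shift: "eX (l - mul k) * (1 - eX (- sroot i)) = eX (l - mul k) - eX (l - mul (k + 1))" for k
    by (cases i; cases l) (simp_all add: algebra_simps eX_mult mul_def)
  have "\<exists>f. f * (1 - eX (- sroot i)) = eX l - eX (l - mul k)" for k
  proof (induction k rule: int_induct [of _ 0])
    case base
    show ?case by (rule exI [of _ 0]) (cases l, simp add: mul_def)
  next
    case (step1 k)
    then obtain f where f: "f * (1 - eX (- sroot i)) = eX l - eX (l - mul k)" by blast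
    show ?case
      by (rule exI [of _ "f + eX (l - mul k)"]) (simp only: distrib_right f shift, simp)
  next
    case (step2 k)
    then obtain f where f: "f * (1 - eX (- sroot i)) = eX l - eX (l - mul k)" by blast
    show ?case
      by (rule exI [of _ "f - eX (l - mul (k - 1))"]) (simp only: left_diff_distrib f shift, simp)
  qed
  from this [of "pairing l i"] show ?thesis
    by (cases l) (simp add: mul_def srefl_def)
qed

lemma lookup_mult_eX: "Poly_Mapping.lookup (f * eX a) l = Poly_Mapping.lookup f (l - a)"
proof (induction f rule: update_induct)
  case const
  show ?case by simp
next
  case (update f k v)
  have "Poly_Mapping.update k v f = f + Poly_Mapping.single k v"
    using update.hyps
    by (intro poly_mapping_eqI) (auto simp: lookup_update lookup_add lookup_single when_def in_keys_iff)
  moreover have "Poly_Mapping.lookup (Poly_Mapping.single k v * eX a) l =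
      Poly_Mapping.lookup (Poly_Mapping.single k v) (l - a)"
    by (auto simp: eX_def mult_single lookup_single when_def)
  ultimately show ?case using update.IH by (simp add: distrib_right lookup_add)
qed

lemma fraction_unique:
  assumes "f * (1 - eX (- sroot i)) = g * (1 - eX (- sroot i))"
  shows "f = g"
proof -
  define h where "h = f - g"
  have "h * (1 - eX (- sroot i)) = 0"
    using assms by (simp add: h_def left_diff_distrib)
  then have "h = h * eX (- sroot i)" by (simp add: right_diff_distrib)
  then have per: "Poly_Mapping.lookup h l = Poly_Mapping.lookup h (l + sroot i)" for l
    by (metis diff_minus_eq_add lookup_mult_eX)
  have "Poly_Mapping.lookup h l = 0" for l
  proof (rule ccontr)
    assume nz: "Poly_Mapping.lookup h l \<noteq> 0"
    define s where "s n = (fst l + int n * fst (sroot i), snd l + int n * snd (sroot i))" for n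
    have "Poly_Mapping.lookup h (s n) = Poly_Mapping.lookup h l" for n
    proof (induction n)
      case 0
      show ?case by (cases l) (simp add: s_def)
    next
      case (Suc n)
      have "s (Suc n) = s n + sroot i" by (cases i) (simp_all add: s_def)
      with Suc per [of "s n"] show ?case by simp
    qed
    with nz have "range s \<subseteq> Poly_Mapping.keys h" by (auto simp: in_keys_iff)
    moreover have "inj s" by (cases i) (auto simp: inj_def s_def)
    ultimately show False
      by (meson finite_keys finite_subset infinite_UNIV_nat finite_imageD)
  qed
  then have "h = 0" by (simp add: poly_mapping_eqI)
  then show ?thesis by (simp add: h_def)
qed

text \<open>In the last family, \<open>f\<close> is the fraction
  \<open>(X\<^sup>\<lambda> - X\<^bsup>s\<^sub>i\<lambda>\<^esup>) / (1 - X\<^bsup>-\<alpha>\<^sub>i\<^esup>)\<close>: it exists and is unique by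
  \<open>fraction_exists\<close> and \<open>fraction_unique\<close>.\<close>

definition hecke_rels :: "complex \<Rightarrow> falg set" where
  "hecke_rels q =
     {FT i * FT i - (FC (q - inverse q) * FT i + 1) | i. True}
   \<union> {FT N1 * FT N2 * FT N1 * FT N2 * FT N1 * FT N2 - FT N2 * FT N1 * FT N2 * FT N1 * FT N2 * FT N1}
   \<union> {FX 0 - 1}
   \<union> {FX l * FX m - FX (l + m) | l m. True}
   \<union> {FX l * FT i - (FT i * FX (srefl i l) + FC (q - inverse q) * FX_lin f) | l i f.
        f * (1 - eX (- sroot i)) = eX l - eX (srefl i l)}"

definition free_ring :: "falg ring" where
  "free_ring = \<lparr>carrier = UNIV, monoid.mult = (*), one = 1, ring.zero = 0, add = (+)\<rparr>"

lemma ring_free_ring: "ring free_ring"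
proof (rule ringI)
  show "abelian_group free_ring"
  proof (rule abelian_groupI)
    fix x :: falg assume "x \<in> carrier free_ring"
    show "\<exists>y\<in>carrier free_ring. y \<oplus>\<^bsub>free_ring\<^esub> x = \<zero>\<^bsub>free_ring\<^esub>"
      by (rule bexI [of _ "- x"]) (simp_all add: free_ring_def)
  qed (simp_all add: free_ring_def algebra_simps)
  show "monoid free_ring"
    by (rule monoidI) (simp_all add: free_ring_def algebra_simps)
qed (simp_all add: free_ring_def algebra_simps)

type_synonym hecke_elt = "falg set"

definition hecke_ideal :: "complex \<Rightarrow> falg set" where
  "hecke_ideal q = Idl\<^bsub>free_ring\<^esub> (hecke_rels q)"

definition hecke :: "complex \<Rightarrow> hecke_elt ring" where
  "hecke q = free_ring Quot (hecke_ideal q)"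

lemma ring_hecke: "ring (hecke q)"
  unfolding hecke_def hecke_ideal_def
  by (rule ideal.quotient_is_ring, rule ring.genideal_ideal[OF ring_free_ring])
     (simp add: free_ring_def)

definition HC :: "complex \<Rightarrow> complex \<Rightarrow> hecke_elt" where
  "HC q c = hecke_ideal q +>\<^bsub>free_ring\<^esub> FC c"

definition HT :: "complex \<Rightarrow> node \<Rightarrow> hecke_elt" where
  "HT q i = hecke_ideal q +>\<^bsub>free_ring\<^esub> FT i"

definition HX :: "complex \<Rightarrow> lattice \<Rightarrow> hecke_elt" where
  "HX q l = hecke_ideal q +>\<^bsub>free_ring\<^esub> FX l"

text \<open>A subalgebra is a subring containing the scalars.\<close>

definition hecke_sub :: "complex \<Rightarrow> node \<Rightarrow> hecke_elt ring" where
  "hecke_sub q i = (hecke q)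
     \<lparr>carrier := generate_ring (hecke q) (range (HC q) \<union> {HT q i} \<union> range (HX q))\<rparr>"

section \<open>Left modules over noncommutative rings\<close>

text \<open>The locale \<^locale>\<open>module\<close> requires a commutative ring, so only its record type is reused;
  the ring multiplication and unit of that record play no role. The locale
  \<^locale>\<open>submodule\<close> makes no commutativity assumption.\<close>

locale left_module = R?: ring R + M?: abelian_group M
  for R :: "('a, 'r) ring_scheme" (structure) and M :: "('a, 'b, 'm) module_scheme" (structure) +
  assumes smult_closed [simp, intro]:
      "\<lbrakk>a \<in> carrier R; x \<in> carrier M\<rbrakk> \<Longrightarrow> a \<odot>\<^bsub>M\<^esub> x \<in> carrier M"
    and smult_l_distr:
      "\<lbrakk>a \<in> carrier R; b \<in> carrier R; x \<in> carrier M\<rbrakk> \<Longrightarrow>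
       (a \<oplus> b) \<odot>\<^bsub>M\<^esub> x = a \<odot>\<^bsub>M\<^esub> x \<oplus>\<^bsub>M\<^esub> b \<odot>\<^bsub>M\<^esub> x"
    and smult_r_distr:
      "\<lbrakk>a \<in> carrier R; x \<in> carrier M; y \<in> carrier M\<rbrakk> \<Longrightarrow>
       a \<odot>\<^bsub>M\<^esub> (x \<oplus>\<^bsub>M\<^esub> y) = a \<odot>\<^bsub>M\<^esub> x \<oplus>\<^bsub>M\<^esub> a \<odot>\<^bsub>M\<^esub> y"
    and smult_assoc:
      "\<lbrakk>a \<in> carrier R; b \<in> carrier R; x \<in> carrier M\<rbrakk> \<Longrightarrow>
       (a \<otimes> b) \<odot>\<^bsub>M\<^esub> x = a \<odot>\<^bsub>M\<^esub> (b \<odot>\<^bsub>M\<^esub> x)"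
    and smult_one [simp]: "x \<in> carrier M \<Longrightarrow> \<one> \<odot>\<^bsub>M\<^esub> x = x"

definition irreducible_module :: "'a ring \<Rightarrow> ('a, 'b) module \<Rightarrow> bool" where
  "irreducible_module R M \<longleftrightarrow>
     left_module R M \<and> carrier M \<noteq> {\<zero>\<^bsub>M\<^esub>} \<and>
     (\<forall>U. submodule U R M \<longrightarrow> U = {\<zero>\<^bsub>M\<^esub>} \<or> U = carrier M)"

text \<open>The tensor product \<open>R \<otimes>\<^sub>A V\<close> for a subring \<open>A\<close> of \<open>R\<close> (given by its carrier) and a left
  \<open>A\<close>-module \<open>V\<close>: the free abelian group on \<open>R \<times> V\<close> modulo the biadditivity and
  balancing relations, on which \<open>R\<close> acts by left multiplication on the first factor.\<close>

definition tensor_free :: "'a ring \<Rightarrow> ('a, 'v) module \<Rightarrow> (('a \<times> 'v) \<Rightarrow>\<^sub>0 int) monoid" where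
  "tensor_free R V = free_Abelian_group (carrier R \<times> carrier V)"

definition tensor_rels :: "'a ring \<Rightarrow> 'a set \<Rightarrow> ('a, 'v) module \<Rightarrow> (('a \<times> 'v) \<Rightarrow>\<^sub>0 int) set" where
  "tensor_rels R A V =
     {frag_of (x \<oplus>\<^bsub>R\<^esub> y, v) - frag_of (x, v) - frag_of (y, v) | x y v.
        x \<in> carrier R \<and> y \<in> carrier R \<and> v \<in> carrier V}
   \<union> {frag_of (x, v \<oplus>\<^bsub>V\<^esub> w) - frag_of (x, v) - frag_of (x, w) | x v w.
        x \<in> carrier R \<and> v \<in> carrier V \<and> w \<in> carrier V}
   \<union> {frag_of (x \<otimes>\<^bsub>R\<^esub> a, v) - frag_of (x, a \<odot>\<^bsub>V\<^esub> v) | x a v.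
        x \<in> carrier R \<and> a \<in> A \<and> v \<in> carrier V}"

definition tensor_null :: "'a ring \<Rightarrow> 'a set \<Rightarrow> ('a, 'v) module \<Rightarrow> (('a \<times> 'v) \<Rightarrow>\<^sub>0 int) set" where
  "tensor_null R A V = generate (tensor_free R V) (tensor_rels R A V)"

definition tensor ::
  "'a ring \<Rightarrow> 'a set \<Rightarrow> ('a, 'v) module \<Rightarrow> ('a, (('a \<times> 'v) \<Rightarrow>\<^sub>0 int) set) module" where
  "tensor R A V = (let F = tensor_free R V; D = tensor_null R A V in
     \<lparr>carrier = carrier (F Mod D), monoid.mult = undefined, one = undefined,
      ring.zero = D, add = monoid.mult (F Mod D),
      smult = (\<lambda>x C. \<Union>c\<in>C. D #>\<^bsub>F\<^esub> frag_extend (\<lambda>(y, v). frag_of (x \<otimes>\<^bsub>R\<^esub> y, v)) c)\<rparr>)"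

section \<open>Induced modules\<close>

text \<open>\<open>V = \<complex>v\<close> is a one-dimensional module over the subalgebra of node \<open>i\<close>, with
  \<open>T\<^sub>i v = c v\<close> and \<open>X\<^sup>\<lambda> v = t(X\<^sup>\<lambda>) v\<close>.\<close>

definition line_module ::
  "complex \<Rightarrow> node \<Rightarrow> complex \<Rightarrow> (lattice \<Rightarrow> complex) \<Rightarrow> (hecke_elt, 'v) module \<Rightarrow> 'v \<Rightarrow> bool" where
  "line_module q i c t V v \<longleftrightarrow>
     left_module (hecke_sub q i) V \<and> v \<in> carrier V \<and>
     bij_betw (\<lambda>z. HC q z \<odot>\<^bsub>V\<^esub> v) UNIV (carrier V) \<and>
     HT q i \<odot>\<^bsub>V\<^esub> v = HC q c \<odot>\<^bsub>V\<^esub> v \<and>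
     (\<forall>l. HX q l \<odot>\<^bsub>V\<^esub> v = HC q (t l) \<odot>\<^bsub>V\<^esub> v)"

definition induced ::
  "complex \<Rightarrow> node \<Rightarrow> (hecke_elt, 'v) module \<Rightarrow> (hecke_elt, ((hecke_elt \<times> 'v) \<Rightarrow>\<^sub>0 int) set) module" where
  "induced q i V = tensor (hecke q) (carrier (hecke_sub q i)) V"

end

theory Submission
  imports Defs "HOL-Analysis.Cartesian_Space"
begin

text \<open>
  Put \<open>p = q / r\<close>. Then \<open>q = p\<^sup>3\<close> and \<open>r = p\<^sup>2\<close>, so that \<open>t = (p\<^sup>2, 1)\<close> and
  \<open>t' = s\<^sub>1t = (p\<^bsup>-2\<^esup>, p\<^sup>6)\<close>, where a weight is given by its values at \<open>\<alpha>\<^sub>1\<close> and \<open>\<alpha>\<^sub>2\<close>. The weights of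
  the six-dimensional module \<open>M\<close> are \<open>t\<close> and \<open>t'\<close>, both with multiplicity two, and
  \<open>s\<^sub>2t' = (p\<^sup>4, p\<^bsup>-6\<^esup>)\<close> and \<open>s\<^sub>1s\<^sub>2t' = (p\<^bsup>-4\<^esup>, p\<^sup>6)\<close>, both with multiplicity one. The hypotheses on
  \<open>q\<close> and \<open>r\<close> make these weights distinct and make the intertwining operators for \<open>s\<^sub>1\<close> between \<open>t\<close> and
  \<open>t'\<close>, and between \<open>s\<^sub>2t'\<close> and \<open>s\<^sub>1s\<^sub>2t'\<close>, invertible. Since \<open>s\<^sub>2\<close> fixes \<open>t\<close>, the generalised weight
  space of \<open>t\<close> is an irreducible module over the parabolic subalgebra of node 2, on which \<open>X\<close> acts by
  a nontrivial Jordan block. The intertwiner carries this block to \<open>t'\<close>, where it is nontrivial for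
  \<open>X\<close> at \<open>\<alpha>\<^sub>2\<close>. If \<open>T\<^sub>2\<close> preserved the generalised weight space of \<open>t'\<close>, then \<open>X\<close> at \<open>\<alpha>\<^sub>2\<close> would be
  a scalar there; so the weight \<open>s\<^sub>2t'\<close>, and with it \<open>s\<^sub>1s\<^sub>2t'\<close>, occurs in every submodule that
  contains \<open>t\<close>. Conversely a nonzero submodule can be moved into the weight space of \<open>t\<close>.

  This argument is carried out in an explicit six-dimensional module (\<open>stable_imp_everything\<close>). The
  induced module is compared with it as follows. Write \<open>v\<close> for the generator of the line and
  \<open>T\<^sub>w\<close> for the alternating words of length at most five that end in \<open>T\<^sub>1\<close>. The Bernstein and quadratic
  relations show that the six vectors \<open>T\<^sub>wv\<close> span any cyclic module generated by such a \<open>v\<close>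
  (\<open>cyclic_left_ideal.span_everything\<close>). In the explicit module six vectors that span are linearly
  independent, so that the annihilator of \<open>v\<close> is the same left ideal in both modules
  (\<open>orbit_inj\<close>, \<open>induced_irreducible\<close>). The span of the \<open>T\<^sub>wv\<close> also yields the braid relation in the
  explicit module, because on these vectors it follows from the quadratic relations and from the
  action of \<open>T\<^sub>2\<close> on the first and the last of them (\<open>opT_braid\<close>).

  The module \<open>N\<close> is covered by the same statement: the defining relations of the algebra depend on
  \<open>q\<close> only through \<open>q - q\<^bsup>-1\<^esup>\<close>, and \<open>(q, r) \<mapsto> (-q\<^bsup>-1\<^esup>, r\<^bsup>-1\<^esup>)\<close> exchanges the data of \<open>M\<close> and \<open>N\<close>.
\<close>

section \<open>Tensor products over a subring\<close>

locale tensor_product = R?: ring R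
  for R :: "'a ring" (structure) and A :: "'a set" and V :: "('a, 'v) module" +
  assumes A_subset: "A \<subseteq> carrier R" and V_module: "left_module (R\<lparr>carrier := A\<rparr>) V"
begin

interpretation V: left_module "R\<lparr>carrier := A\<rparr>" V by (rule V_module)

abbreviation F where "F \<equiv> tensor_free R V"
abbreviation D where "D \<equiv> tensor_null R A V"
abbreviation M where "M \<equiv> tensor R A V"
abbreviation S where "S \<equiv> carrier R \<times> carrier V"

lemma V_smult_closed: "a \<in> A \<Longrightarrow> v \<in> carrier V \<Longrightarrow> a \<odot>\<^bsub>V\<^esub> v \<in> carrier V"
  using V.smult_closed by simp

lemma in_F_iff [simp]: "c \<in> carrier F \<longleftrightarrow> Poly_Mapping.keys c \<subseteq> S"
  by (simp add: tensor_free_def)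

lemma F_mult [simp]: "x \<otimes>\<^bsub>F\<^esub> y = x + y"
  by (simp add: tensor_free_def)

interpretation F: comm_group F
  unfolding tensor_free_def by (rule abelian_free_Abelian_group)

lemma rels_subset: "tensor_rels R A V \<subseteq> carrier F"
proof -
  have "frag_of (x, v) \<in> carrier F" if "x \<in> carrier R" "v \<in> carrier V" for x v
    using that by simp
  moreover have "c - d \<in> carrier F" if "c \<in> carrier F" "d \<in> carrier F" for c d
    using that keys_diff [of c d] by auto
  ultimately show ?thesis
    unfolding tensor_rels_def using A_subset V_smult_closed
    by (auto simp del: in_F_iff)
qed

lemma D_subgroup: "subgroup D F"
  unfolding tensor_null_def by (rule F.generate_is_subgroup [OF rels_subset])

lemma D_F: "c \<in> D \<Longrightarrow> c \<in> carrier F"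
  using subgroup.subset [OF D_subgroup] by blast

lemma D_0 [simp]: "0 \<in> D"
  using subgroup.one_closed [OF D_subgroup] by (simp add: tensor_free_def)

lemma D_add: "c \<in> D \<Longrightarrow> d \<in> D \<Longrightarrow> c + d \<in> D"
  using subgroup.m_closed [OF D_subgroup] by simp

lemma D_minus: "c \<in> D \<Longrightarrow> - c \<in> D"
  using subgroup.m_inv_closed [OF D_subgroup, of c] D_F [of c]
  by (simp add: tensor_free_def)

lemma D_diff: "c \<in> D \<Longrightarrow> d \<in> D \<Longrightarrow> c - d \<in> D"
  using D_add [of c "- d"] D_minus by simp

lemma rels_D: "c \<in> tensor_rels R A V \<Longrightarrow> c \<in> D"
  unfolding tensor_null_def by (rule generate.incl)

lemma D_left: "x \<in> carrier R \<Longrightarrow> y \<in> carrier R \<Longrightarrow> v \<in> carrier V \<Longrightarrow>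
    frag_of (x \<oplus> y, v) - frag_of (x, v) - frag_of (y, v) \<in> D"
  by (rule rels_D) (unfold tensor_rels_def, blast)

lemma D_right: "x \<in> carrier R \<Longrightarrow> v \<in> carrier V \<Longrightarrow> w \<in> carrier V \<Longrightarrow>
    frag_of (x, v \<oplus>\<^bsub>V\<^esub> w) - frag_of (x, v) - frag_of (x, w) \<in> D"
  by (rule rels_D) (unfold tensor_rels_def, blast)

lemma D_balanced: "x \<in> carrier R \<Longrightarrow> a \<in> A \<Longrightarrow> v \<in> carrier V \<Longrightarrow>
    frag_of (x \<otimes> a, v) - frag_of (x, a \<odot>\<^bsub>V\<^esub> v) \<in> D"
  by (rule rels_D) (unfold tensor_rels_def, blast)

definition tcls :: "(('a \<times> 'v) \<Rightarrow>\<^sub>0 int) \<Rightarrow> (('a \<times> 'v) \<Rightarrow>\<^sub>0 int) set" where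
  "tcls c = D #>\<^bsub>F\<^esub> c"

lemma tcls_alt: "tcls c = (\<lambda>d. d + c) ` D"
  by (auto simp: tcls_def r_coset_def)

lemma tcls_eq_iff: "tcls c = tcls d \<longleftrightarrow> c - d \<in> D"
proof
  assume "tcls c = tcls d"
  moreover have "c \<in> tcls c" unfolding tcls_alt by (rule image_eqI [of _ _ 0]) simp_all
  ultimately have "c \<in> tcls d" by simp
  then show "c - d \<in> D" by (auto simp: tcls_alt)
next
  have sub: "tcls c \<subseteq> tcls d" if cd: "c - d \<in> D" for c d
  proof
    fix e assume "e \<in> tcls c"
    then obtain f where "f \<in> D" "e = f + c" by (auto simp: tcls_alt)
    then show "e \<in> tcls d"
      unfolding tcls_alt by (intro image_eqI [of _ _ "f + (c - d)"] D_add cd) simp_all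
  qed
  assume "c - d \<in> D"
  moreover from D_minus [OF this] have "d - c \<in> D" by simp
  ultimately show "tcls c = tcls d" using sub by blast
qed

lemma tcls_0: "tcls 0 = D" by (simp add: tcls_alt)

lemma carrier_M: "carrier M = tcls ` carrier F"
  by (simp add: tensor_def Let_def carrier_FactGroup tcls_def [abs_def])

lemma zero_M: "\<zero>\<^bsub>M\<^esub> = tcls 0"
  by (simp add: tensor_def Let_def tcls_0)

lemma add_M: "c \<in> carrier F \<Longrightarrow> d \<in> carrier F \<Longrightarrow> tcls c \<oplus>\<^bsub>M\<^esub> tcls d = tcls (c + d)"
  using normal.rcos_sum [OF F.subgroup_imp_normal [OF D_subgroup], of c d]
  by (simp add: tensor_def Let_def tcls_def)

text \<open>Left multiplication on the first factor, before the tensor relations are imposed.\<close>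

definition mul :: "'a \<Rightarrow> (('a \<times> 'v) \<Rightarrow>\<^sub>0 int) \<Rightarrow> (('a \<times> 'v) \<Rightarrow>\<^sub>0 int)" where
  "mul r = frag_extend (\<lambda>(y, v). frag_of (r \<otimes> y, v))"

lemma mul_of [simp]: "mul r (frag_of (x, v)) = frag_of (r \<otimes> x, v)"
  by (simp add: mul_def)

lemma mul_add: "mul r (c + d) = mul r c + mul r d"
  and mul_diff: "mul r (c - d) = mul r c - mul r d"
  and mul_0 [simp]: "mul r 0 = 0"
  by (simp_all add: mul_def frag_extend_add frag_extend_diff)

lemma mul_closed:
  assumes "r \<in> carrier R" "c \<in> carrier F"
  shows "mul r c \<in> carrier F"
proof -
  from assms(2) have "Poly_Mapping.keys c \<subseteq> S" by simp
  then show ?thesis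
  proof (induction c rule: frag_induction)
    case (one x)
    then show ?case using assms(1) by (cases x) simp
  next
    case (diff c d)
    then show ?case using keys_diff [of "mul r c" "mul r d"] by (auto simp: mul_diff)
  qed simp
qed

lemma mul_rels:
  assumes "r \<in> carrier R" "c \<in> tensor_rels R A V"
  shows "mul r c \<in> D"
  using assms(2) unfolding tensor_rels_def
proof (elim UnE CollectE exE conjE)
  fix x y v
  assume "c = frag_of (x \<oplus> y, v) - frag_of (x, v) - frag_of (y, v)"
    "x \<in> carrier R" "y \<in> carrier R" "v \<in> carrier V"
  then show ?thesis using assms(1) by (simp add: mul_diff r_distr D_left)
next
  fix x v w
  assume "c = frag_of (x, v \<oplus>\<^bsub>V\<^esub> w) - frag_of (x, v) - frag_of (x, w)"
    "x \<in> carrier R" "v \<in> carrier V" "w \<in> carrier V"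
  then show ?thesis using assms(1) by (simp add: mul_diff D_right)
next
  fix x a v
  assume "c = frag_of (x \<otimes> a, v) - frag_of (x, a \<odot>\<^bsub>V\<^esub> v)" "x \<in> carrier R" "a \<in> A" "v \<in> carrier V"
  then show ?thesis
    using assms(1) A_subset D_balanced [of "r \<otimes> x" a v] by (auto simp: mul_diff m_assoc)
qed

lemma mul_D:
  assumes "r \<in> carrier R" "c \<in> D"
  shows "mul r c \<in> D"
  using assms(2) [unfolded tensor_null_def]
proof induction
  case one
  show ?case by (simp add: tensor_free_def)
next
  case (incl c)
  with assms(1) show ?case by (rule mul_rels)
next
  case (inv c)
  then have "c \<in> carrier F" using rels_subset by blast
  moreover have "mul r (- c) \<in> D"
    using D_minus [OF mul_rels [OF assms(1) inv]] mul_diff [of r 0 c] by simp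
  ultimately show ?case by (simp add: tensor_free_def)
next
  case (eng c d)
  then show ?case by (simp add: mul_add D_add)
qed

text \<open>The scalar multiplication of the tensor product is a union over all representatives; left
  multiplication preserves the relations, so that one representative suffices.\<close>

lemma smult_M:
  assumes "r \<in> carrier R" "c \<in> carrier F"
  shows "r \<odot>\<^bsub>M\<^esub> tcls c = tcls (mul r c)"
proof -
  have "r \<odot>\<^bsub>M\<^esub> tcls c = (\<Union>d\<in>tcls c. tcls (mul r d))"
    by (simp add: tensor_def Let_def mul_def tcls_def)
  moreover have "tcls (mul r d) = tcls (mul r c)" if "d \<in> tcls c" for d
    using that mul_D [OF assms(1)] unfolding tcls_eq_iff by (auto simp: tcls_alt mul_add)
  moreover have "tcls c \<noteq> {}" unfolding tcls_alt using D_0 by blast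
  ultimately show ?thesis by auto
qed

lemma F_add: "c \<in> carrier F \<Longrightarrow> d \<in> carrier F \<Longrightarrow> c + d \<in> carrier F"
  using F.m_closed by simp

lemma F_0: "0 \<in> carrier F"
  by simp

lemma F_diff: "c \<in> carrier F \<Longrightarrow> d \<in> carrier F \<Longrightarrow> c - d \<in> carrier F"
  using keys_diff [of c d] by auto

lemma F_minus: "c \<in> carrier F \<Longrightarrow> - c \<in> carrier F"
  by simp

lemma abelian_group_M: "abelian_group M"
proof (rule abelian_groupI)
  fix x assume "x \<in> carrier M"
  then obtain c where c: "c \<in> carrier F" "x = tcls c" by (auto simp: carrier_M)
  show "\<exists>y\<in>carrier M. y \<oplus>\<^bsub>M\<^esub> x = \<zero>\<^bsub>M\<^esub>"
    by (rule bexI [of _ "tcls (- c)"])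
       (use c F_minus in \<open>auto simp: add_M zero_M carrier_M simp del: in_F_iff\<close>)
qed (auto simp: carrier_M zero_M add_M F_add F_0 algebra_simps simp del: in_F_iff intro: imageI)

theorem left_module_tensor: "left_module R M"
proof (intro left_module.intro left_module_axioms.intro)
  show "ring R" by (rule R.ring_axioms)
  show "abelian_group M" by (rule abelian_group_M)
next
  fix a x assume "a \<in> carrier R" "x \<in> carrier M"
  then show "a \<odot>\<^bsub>M\<^esub> x \<in> carrier M"
    by (auto simp: carrier_M smult_M mul_closed simp del: in_F_iff)
next
  fix a b x assume a: "a \<in> carrier R" and b: "b \<in> carrier R" and "x \<in> carrier M"
  then obtain c where c: "c \<in> carrier F" "x = tcls c" by (auto simp: carrier_M)
  from c(1) have S: "Poly_Mapping.keys c \<subseteq> S" by simp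
  then have "mul (a \<oplus> b) c - (mul a c + mul b c) \<in> D"
  proof (induction c rule: frag_induction)
    case (one x)
    then show ?case using a b D_left [of "a \<otimes> fst x" "b \<otimes> fst x" "snd x"]
      by (cases x) (auto simp: l_distr algebra_simps)
  next
    case (diff c d)
    from D_diff [OF this] show ?case by (simp add: mul_diff algebra_simps)
  qed simp
  then show "(a \<oplus> b) \<odot>\<^bsub>M\<^esub> x = a \<odot>\<^bsub>M\<^esub> x \<oplus>\<^bsub>M\<^esub> b \<odot>\<^bsub>M\<^esub> x"
    using a b c by (simp add: smult_M add_M mul_closed tcls_eq_iff del: in_F_iff)
  from S have "mul (a \<otimes> b) c = mul a (mul b c)"
  proof (induction c rule: frag_induction)
    case (one x)
    then show ?case using a b by (cases x) (simp add: m_assoc)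
  qed (simp_all add: mul_diff)
  then show "(a \<otimes> b) \<odot>\<^bsub>M\<^esub> x = a \<odot>\<^bsub>M\<^esub> (b \<odot>\<^bsub>M\<^esub> x)"
    using a b c by (simp add: smult_M mul_closed del: in_F_iff)
next
  fix a x y assume "a \<in> carrier R" "x \<in> carrier M" "y \<in> carrier M"
  then show "a \<odot>\<^bsub>M\<^esub> (x \<oplus>\<^bsub>M\<^esub> y) = a \<odot>\<^bsub>M\<^esub> x \<oplus>\<^bsub>M\<^esub> a \<odot>\<^bsub>M\<^esub> y"
    by (auto simp: carrier_M smult_M add_M mul_add mul_closed F_add simp del: in_F_iff)
next
  fix x assume "x \<in> carrier M"
  then obtain c where c: "c \<in> carrier F" "x = tcls c" by (auto simp: carrier_M)
  from c(1) have "Poly_Mapping.keys c \<subseteq> S" by simp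
  then have "mul \<one> c = c"
    by (induction c rule: frag_induction) (auto simp: mul_diff)
  then show "\<one> \<odot>\<^bsub>M\<^esub> x = x" using c by (simp add: smult_M del: in_F_iff)
qed

definition pure :: "'a \<Rightarrow> 'v \<Rightarrow> (('a \<times> 'v) \<Rightarrow>\<^sub>0 int) set" where
  "pure x v = tcls (frag_of (x, v))"

lemma pure_closed: "x \<in> carrier R \<Longrightarrow> v \<in> carrier V \<Longrightarrow> pure x v \<in> carrier M"
  unfolding pure_def carrier_M by (rule imageI) simp

lemma smult_pure:
  "r \<in> carrier R \<Longrightarrow> x \<in> carrier R \<Longrightarrow> v \<in> carrier V \<Longrightarrow> r \<odot>\<^bsub>M\<^esub> pure x v = pure (r \<otimes> x) v"
  by (simp add: pure_def smult_M)

lemma pure_add: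
  "x \<in> carrier R \<Longrightarrow> y \<in> carrier R \<Longrightarrow> v \<in> carrier V \<Longrightarrow>
    pure (x \<oplus> y) v = pure x v \<oplus>\<^bsub>M\<^esub> pure y v"
  using D_left [of x y v] by (simp add: pure_def add_M tcls_eq_iff diff_diff_eq)

lemma pure_balanced:
  "x \<in> carrier R \<Longrightarrow> a \<in> A \<Longrightarrow> v \<in> carrier V \<Longrightarrow> pure (x \<otimes> a) v = pure x (a \<odot>\<^bsub>V\<^esub> v)"
  using D_balanced [of x a v] by (simp add: pure_def tcls_eq_iff)

text \<open>A generator \<open>v\<close> of \<open>V\<close> absorbs the second factor, because scalars from \<open>A\<close> move across the tensor
  sign; sums of tensors with the same second factor are pure.\<close>

lemma pure_cases:
  assumes v: "v \<in> carrier V" and gen: "\<And>w. w \<in> carrier V \<Longrightarrow> \<exists>a\<in>A. w = a \<odot>\<^bsub>V\<^esub> v"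
    and C: "C \<in> carrier M"
  shows "\<exists>x\<in>carrier R. C = pure x v"
proof -
  obtain c where c: "Poly_Mapping.keys c \<subseteq> S" "C = tcls c"
    using C by (auto simp: carrier_M)
  from c(1) have "\<exists>x\<in>carrier R. c - frag_of (x, v) \<in> D"
  proof (induction c rule: frag_induction)
    case zero
    from D_left [OF R.zero_closed R.zero_closed v]
    show ?case by (intro bexI [of _ \<zero>]) simp_all
  next
    case (one xw)
    then obtain x w where x: "xw = (x, w)" "x \<in> carrier R" "w \<in> carrier V" by auto
    then obtain a where a: "a \<in> A" "w = a \<odot>\<^bsub>V\<^esub> v" using gen by blast
    from D_minus [OF D_balanced [OF x(2) a(1) v]] show ?case
      using x a A_subset by (intro bexI [of _ "x \<otimes> a"]) auto
  next
    case (diff c d)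
    then obtain x y where x: "x \<in> carrier R" "c - frag_of (x, v) \<in> D"
      and y: "y \<in> carrier R" "d - frag_of (y, v) \<in> D" by blast
    have "x \<ominus> y \<oplus> y = x" using x(1) y(1) by algebra
    with D_left [of "x \<ominus> y" y v] have "frag_of (x, v) - frag_of (x \<ominus> y, v) - frag_of (y, v) \<in> D"
      using x(1) y(1) v by simp
    from D_add [OF D_diff [OF x(2) y(2)] this] show ?case
      using x(1) y(1) by (intro bexI [of _ "x \<ominus> y"]) (simp_all add: algebra_simps)
  qed
  then show ?thesis unfolding c(2) pure_def tcls_eq_iff .
qed

text \<open>The universal property, in the form that bounds the tensor product from below: a balanced
  biadditive map detects nonzero pure tensors.\<close>

lemma pure_eq_zero_imp:
  fixes b :: "'a \<Rightarrow> 'v \<Rightarrow> 'g :: ab_group_add"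
  assumes left: "\<And>x y v. x \<in> carrier R \<Longrightarrow> y \<in> carrier R \<Longrightarrow> v \<in> carrier V \<Longrightarrow> b (x \<oplus> y) v = b x v + b y v"
    and right: "\<And>x v w. x \<in> carrier R \<Longrightarrow> v \<in> carrier V \<Longrightarrow> w \<in> carrier V \<Longrightarrow> b x (v \<oplus>\<^bsub>V\<^esub> w) = b x v + b x w"
    and bal: "\<And>x a v. x \<in> carrier R \<Longrightarrow> a \<in> A \<Longrightarrow> v \<in> carrier V \<Longrightarrow> b (x \<otimes> a) v = b x (a \<odot>\<^bsub>V\<^esub> v)"
    and x: "x \<in> carrier R" and v: "v \<in> carrier V" and zero: "pure x v = \<zero>\<^bsub>M\<^esub>"
  shows "b x v = 0"
proof -
  define G where "G = \<lparr>carrier = (UNIV :: 'g set), monoid.mult = (+), one = (0 :: 'g)\<rparr>"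
  interpret G: comm_group G
    by (rule comm_groupI) (auto simp: G_def ac_simps intro: exI [of _ "- _"])
  obtain h where h: "h \<in> hom F G" "\<And>z. z \<in> S \<Longrightarrow> h (frag_of z) = case_prod b z"
    using G.free_Abelian_group_universal [of "case_prod b" S]
    unfolding tensor_free_def by (auto simp: G_def)
  have h_add: "h (c + d) = h c + h d" if "c \<in> carrier F" "d \<in> carrier F" for c d
    using hom_mult [OF h(1) that] by (simp add: G_def)
  have h_diff: "h (c - d) = h c - h d" if "c \<in> carrier F" "d \<in> carrier F" for c d
    using h_add [OF F_diff [OF that] that(2)] by simp
  have of_F: "frag_of (x, v) \<in> carrier F" if "x \<in> carrier R" "v \<in> carrier V" for x v
    using that by simp
  have h_of: "h (frag_of (x, v)) = b x v" if "x \<in> carrier R" "v \<in> carrier V" for x v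
    using that h(2) by simp
  have rel: "h c = 0" if "c \<in> tensor_rels R A V" for c
  proof -
    have "a \<in> A \<Longrightarrow> a \<in> carrier R" for a using A_subset by blast
    with that show ?thesis
      unfolding tensor_rels_def
      by (auto simp: h_diff h_of of_F F_diff left right bal V_smult_closed simp del: in_F_iff)
  qed
  have "h c = 0" if "c \<in> D" for c
    using that [unfolded tensor_null_def]
  proof induction
    case one
    have "h (0 - 0) = h 0 - h 0" by (rule h_diff) simp_all
    then show ?case by (simp add: tensor_free_def)
  next
    case (incl c)
    then show ?case by (rule rel)
  next
    case (inv c)
    then have "c \<in> carrier F" using rels_subset by blast
    then show ?case using h_diff [of 0 c] h_diff [of 0 0] rel [OF inv]
      by (simp add: tensor_free_def)
  next
    case (eng c d)
    then have "c \<in> D" "d \<in> D" by (simp_all add: tensor_null_def)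
    then show ?case using eng h_add D_F by simp
  qed
  moreover have "frag_of (x, v) \<in> D"
    using zero by (simp add: pure_def zero_M tcls_eq_iff)
  ultimately show ?thesis using h(2) x v by fastforce
qed

end

section \<open>Linear actions of monoid algebras\<close>

lemma poly_mapping_add_induct [case_names zero single add]:
  fixes f :: "'a \<Rightarrow>\<^sub>0 'b::monoid_add"
  assumes "P 0" and "\<And>w c. P (Poly_Mapping.single w c)" and "\<And>f g. P f \<Longrightarrow> P g \<Longrightarrow> P (f + g)"
  shows "P f"
proof (induction f rule: update_induct)
  case const
  show ?case by fact
next
  case (update f k v)
  have "Poly_Mapping.update k v f = f + Poly_Mapping.single k v"
    using update.hyps
    by (intro poly_mapping_eqI) (auto simp: lookup_update lookup_add lookup_single when_def in_keys_iff)
  with update.IH assms show ?case by simp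
qed

text \<open>Collects powers of one base after fractions have been cleared.\<close>

lemma power_merge:
  fixes a b :: "'a :: comm_semiring_1"
  shows "a * a ^ numeral n = a ^ numeral (n + num.One)"
    and "a * (b * a ^ numeral n) = b * a ^ numeral (n + num.One)"
    and "a * a = a\<^sup>2" and "a * (a * b) = a\<^sup>2 * b"
proof -
  have *: "a ^ numeral (n + num.One) = a * a ^ numeral n"
    using power_add [of a "numeral n" 1]
    by (simp only: numeral_plus_one power_one_right mult.commute)
  show "a * a ^ numeral n = a ^ numeral (n + num.One)"
    and "a * (b * a ^ numeral n) = b * a ^ numeral (n + num.One)"
    unfolding * by (rule refl, rule mult.left_commute)
qed (simp_all add: power2_eq_square mult.assoc)

locale linear_action =
  fixes A :: "'w::monoid_add \<Rightarrow> complex^'n \<Rightarrow> complex^'n"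
  assumes A_zero: "A 0 u = u"
    and A_plus: "A (v + w) u = A v (A w u)"
    and A_add: "A w (x + y) = A w x + A w y"
    and A_scale: "A w (c *s x) = c *s A w x"
begin

definition lift :: "('w \<Rightarrow>\<^sub>0 complex) \<Rightarrow> complex^'n \<Rightarrow> complex^'n" where
  "lift f u = (\<Sum>w\<in>Poly_Mapping.keys f. Poly_Mapping.lookup f w *s A w u)"

lemma lift_superset:
  assumes "finite S" "Poly_Mapping.keys f \<subseteq> S"
  shows "lift f u = (\<Sum>w\<in>S. Poly_Mapping.lookup f w *s A w u)"
  unfolding lift_def by (rule sum.mono_neutral_left) (use assms in \<open>auto simp: in_keys_iff\<close>)

lemma lift_0 [simp]: "lift 0 u = 0"
  by (simp add: lift_def)

lemma lift_single [simp]: "lift (Poly_Mapping.single w c) u = c *s A w u"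
  by (simp add: lift_def)

lemma lift_1 [simp]: "lift 1 u = u"
  using lift_single [of 0 1 u] by (simp add: A_zero)

lemma lift_plus: "lift (f + g) u = lift f u + lift g u"
  using keys_add [of f g]
  by (simp add: lift_superset [of "Poly_Mapping.keys f \<union> Poly_Mapping.keys g"]
      lookup_add vec.scale_left_distrib sum.distrib)

lemma lift_minus: "lift (- f) u = - lift f u"
  using lift_plus [of f "- f" u] by (simp add: eq_neg_iff_add_eq_0 add.commute)

lemma lift_diff: "lift (f - g) u = lift f u - lift g u"
  using lift_plus [of f "- g" u] by (simp add: lift_minus)

lemma lift_sum: "lift (\<Sum>i\<in>I. f i) u = (\<Sum>i\<in>I. lift (f i) u)"
  by (induction I rule: infinite_finite_induct) (simp_all add: lift_plus)

lemma lift_add: "lift f (x + y) = lift f x + lift f y"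
  by (simp add: lift_def A_add vec.scale_right_distrib sum.distrib)

lemma lift_scale: "lift f (c *s x) = c *s lift f x"
  by (simp add: lift_def A_scale vec.scale_sum_right mult.commute)

lemma lift_zero [simp]: "lift f 0 = 0"
  using lift_scale [of f 0 0] by simp

lemma lift_mult: "lift (f * g) u = lift f (lift g u)"
proof (induction f rule: poly_mapping_add_induct)
  case (single v c)
  show ?case
  proof (induction g rule: poly_mapping_add_induct)
    case (single w d)
    show ?case by (simp add: mult_single A_plus A_scale)
  next
    case (add g h)
    then show ?case by (simp add: distrib_left lift_plus lift_add)
  qed simp
next
  case (add f h)
  then show ?case by (simp add: distrib_right lift_plus)
qed simp

end

section \<open>A six-dimensional module in a basis of generalised weight vectors\<close>

text \<open>The vectors \<open>A0\<close>, \<open>A1\<close> span the generalised weight space of \<open>t'\<close> and \<open>B0\<close>, \<open>B1\<close> that of \<open>t\<close>; the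
  vector \<open>C\<close> has weight \<open>s\<^sub>2t'\<close>, and \<open>D\<close> is \<open>T\<^sub>1C\<close>. With this choice of \<open>D\<close>, which is not a weight
  vector, the matrices of \<open>T\<^sub>1\<close> and \<open>T\<^sub>2\<close> have Laurent polynomials in \<open>p\<close> as entries.\<close>

datatype basis = A0 | A1 | B0 | B1 | C | D

instance basis :: finite
proof
  have "(UNIV :: basis set) = {A0, A1, B0, B1, C, D}"
    using basis.exhaust by auto
  then show "finite (UNIV :: basis set)" by (metis finite.emptyI finite_insert)
qed

lemma forall_basis: "(\<forall>i. P i) \<longleftrightarrow> P A0 \<and> P A1 \<and> P B0 \<and> P B1 \<and> P C \<and> P D"
  by (metis basis.exhaust)

type_synonym vec6 = "complex^basis"

lemma vec6_eq_iff: "x = y \<longleftrightarrow> x $ A0 = y $ A0 \<and> x $ A1 = y $ A1 \<and> x $ B0 = y $ B0 \<and>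
    x $ B1 = y $ B1 \<and> x $ C = y $ C \<and> x $ D = y $ D" for x y :: vec6
  by (simp add: vec_eq_iff forall_basis)

definition vec6 :: "complex \<Rightarrow> complex \<Rightarrow> complex \<Rightarrow> complex \<Rightarrow> complex \<Rightarrow> complex \<Rightarrow> vec6" where
  "vec6 a0 a1 b0 b1 c d =
    (\<chi> i. case i of A0 \<Rightarrow> a0 | A1 \<Rightarrow> a1 | B0 \<Rightarrow> b0 | B1 \<Rightarrow> b1 | C \<Rightarrow> c | D \<Rightarrow> d)"

lemma vec6_nth [simp]:
  "vec6 a0 a1 b0 b1 c d $ A0 = a0" "vec6 a0 a1 b0 b1 c d $ A1 = a1"
  "vec6 a0 a1 b0 b1 c d $ B0 = b0" "vec6 a0 a1 b0 b1 c d $ B1 = b1"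
  "vec6 a0 a1 b0 b1 c d $ C = c" "vec6 a0 a1 b0 b1 c d $ D = d"
  by (simp_all add: vec6_def)

text \<open>The inverse \<open>u\<close> of \<open>p = q / r\<close> is a parameter of its own, so that Laurent polynomials in \<open>p\<close> are
  polynomials in \<open>p\<close> and \<open>u\<close>.\<close>

locale weight_parameter =
  fixes p u :: complex
  assumes pu: "p * u = 1" and p4: "p ^ 4 \<noteq> 1"
begin

lemma p0: "p \<noteq> 0" and u0: "u \<noteq> 0"
  using pu by auto

lemma u_eq: "u = 1 / p"
  using pu p0 by (simp add: eq_divide_eq mult.commute)

lemmas p_merge = power_merge [where a = p]

text \<open>With \<open>q = p\<^sup>3\<close>, the number \<open>\<kappa>\<close> is \<open>q - q\<^bsup>-1\<^esup>\<close>. The other constants come from the intertwiner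
  \<open>T\<^sub>1 - \<kappa> / (1 - X\<^bsup>-\<alpha>\<^esup>)\<close> for \<open>\<alpha> = \<alpha>\<^sub>1\<close>: the fraction has the values \<open>g = \<kappa> / (1 - p\<^bsup>-2\<^esup>)\<close> at \<open>t\<close> and
  \<open>h = \<kappa> / (1 - p\<^bsup>-4\<^esup>)\<close> at \<open>s\<^sub>2t'\<close>; \<open>m = (g / p)\<^sup>2\<close> is its off-diagonal entry on the Jordan block at
  \<open>t\<close>, and \<open>e = (q + q\<^bsup>-1\<^esup>) h\<close> arises from the replacement of the weight vector of \<open>s\<^sub>1s\<^sub>2t'\<close> by \<open>D\<close>.\<close>

definition \<kappa> :: complex where "\<kappa> = p ^ 3 - u ^ 3"
definition g :: complex where "g = p ^ 3 + p + u"
definition m :: complex where "m = p ^ 4 + 2 * p\<^sup>2 + 3 + 2 * u\<^sup>2 + u ^ 4"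
definition h :: complex where "h = p * (p ^ 6 - 1) / (p ^ 4 - 1)"
definition e :: complex where "e = p ^ 6 + p\<^sup>2 + u\<^sup>2"

lemma h_eq: "h * (p ^ 4 - 1) = p * (p ^ 6 - 1)"
  using p4 by (simp add: h_def)

text \<open>The basis is normalised by \<open>B1 = T\<^sub>2 B0\<close>, by \<open>T\<^sub>2 A1 = A0 + q A1 + C\<close>, by \<open>D = T\<^sub>1 C\<close>, and by the
  condition that the intertwiner for \<open>s\<^sub>1\<close> maps \<open>B0\<close> to \<open>A0\<close> and \<open>B1\<close> to \<open>A1\<close>. The quadratic and
  Bernstein relations then leave no choice for the remaining entries.\<close>

fun opT :: "node \<Rightarrow> vec6 \<Rightarrow> vec6" where
  "opT N1 x = vec6
     ((\<kappa> - g) * x $ A0 - m * x $ A1 + x $ B0)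
     ((\<kappa> - g) * x $ A1 + x $ B1)
     (((\<kappa> - g) * g + 1) * x $ A0 + (\<kappa> - 2 * g) * m * x $ A1 + g * x $ B0 + m * x $ B1)
     (((\<kappa> - g) * g + 1) * x $ A1 + g * x $ B1)
     (x $ D)
     (x $ C + \<kappa> * x $ D)"
| "opT N2 x = vec6
     (p ^ 3 * x $ A0 + x $ A1 - (p ^ 3 + u ^ 3) * x $ C - e * x $ D)
     (p ^ 3 * x $ A1)
     (x $ B1)
     (x $ B0 + \<kappa> * x $ B1)
     (x $ A1 - u ^ 3 * x $ C - e * x $ D)
     (p ^ 3 * x $ D)"

text \<open>The Jordan block at \<open>t\<close> is \<open>X\<^sup>\<lambda> B1 = t(\<lambda>) (B1 + \<kappa> \<langle>\<lambda>, \<alpha>\<^sub>2\<^sup>\<or>\<rangle> B0)\<close>. At \<open>t' = s\<^sub>1t\<close> the linear form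
  \<open>\<lambda> \<mapsto> \<langle>s\<^sub>1\<lambda>, \<alpha>\<^sub>2\<^sup>\<or>\<rangle>\<close> takes its place; it sends \<open>(a, b)\<close> to \<open>a - b\<close>.\<close>

definition opX :: "lattice \<Rightarrow> vec6 \<Rightarrow> vec6" where
  "opX l x = vec6
     (wt (u\<^sup>2) (p ^ 6) l * (x $ A0 + \<kappa> * of_int (fst l - snd l) * x $ A1))
     (wt (u\<^sup>2) (p ^ 6) l * x $ A1)
     (wt (p\<^sup>2) 1 l * (x $ B0 + \<kappa> * of_int (pairing l N2) * x $ B1))
     (wt (p\<^sup>2) 1 l * x $ B1)
     (wt (p ^ 4) (u ^ 6) l * x $ C + h * (wt (p ^ 4) (u ^ 6) l - wt (u ^ 4) (p ^ 6) l) * x $ D)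
     (wt (u ^ 4) (p ^ 6) l * x $ D)"

lemma opT_add: "opT i (x + y) = opT i x + opT i y"
  by (cases i) (simp_all add: vec6_eq_iff algebra_simps)

lemma opT_scale: "opT i (c *s x) = c *s opT i x"
  by (cases i) (simp_all add: vec6_eq_iff algebra_simps)

lemma opT_square: "opT i (opT i x) = \<kappa> *s opT i x + x"
proof (cases i)
  case N1
  show ?thesis by (simp add: N1 vec6_eq_iff algebra_simps)
next
  case N2
  show ?thesis
    by (simp add: N2 vec6_eq_iff \<kappa>_def) (simp add: u_eq p0 field_simps p_merge)
qed

lemma opX_add: "opX l (x + y) = opX l x + opX l y"
  by (simp add: opX_def vec6_eq_iff algebra_simps)

lemma opX_scale: "opX l (c *s x) = c *s opX l x"
  by (simp add: opX_def vec6_eq_iff algebra_simps)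

lemma wt_add: "z \<noteq> 0 \<Longrightarrow> w \<noteq> 0 \<Longrightarrow> wt z w (l + n) = wt z w l * wt z w n"
  by (simp add: wt_def power_int_add)

lemma wt_0: "wt z w 0 = 1"
  by (simp add: wt_def zero_prod_def)

lemma opX_0: "opX 0 x = x"
  by (simp add: opX_def vec6_eq_iff wt_0) (simp add: zero_prod_def)

lemma opX_plus: "opX (l + n) x = opX l (opX n x)"
proof -
  have "pairing (l + n) N2 = pairing l N2 + pairing n N2" by (cases l; cases n) simp
  then show ?thesis
    by (simp add: opX_def vec6_eq_iff wt_add p0 u0 algebra_simps)
qed

lemma wt_nat: "wt z w (numeral a, numeral b) = z ^ numeral a * w ^ numeral b"
  "wt z w (1, numeral b) = z * w ^ numeral b" "wt z w (numeral a, 1) = z ^ numeral a * w"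
  "wt z w (1, 1) = z * w" "wt z w (1, 0) = z" "wt z w (0, 1) = w"
  by (simp_all add: wt_def)

text \<open>The next matrices are those of the lattice vectors on which the Bernstein relation is checked:
  \<open>(3, 2)\<close> is fixed by \<open>s\<^sub>1\<close>, and \<open>(2, 1)\<close> by \<open>s\<^sub>2\<close>, while \<open>(2, 1)\<close> pairs to 1 with the first simple coroot
  and is reflected to \<open>(1, 1)\<close>, and \<open>(1, 1)\<close> pairs to 1 with the second and is reflected to \<open>(1, 0)\<close>. The
  vector \<open>(0, 1)\<close> is \<open>\<alpha>\<^sub>2\<close>, which separates the weight \<open>t\<close> from the others.\<close>

lemma opX_32: "opX (3, 2) x = vec6 (p ^ 6 * (x $ A0 + \<kappa> * x $ A1)) (p ^ 6 * x $ A1)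
    (p ^ 6 * (x $ B0 + \<kappa> * x $ B1)) (p ^ 6 * x $ B1) (x $ C) (x $ D)"
proof -
  have "u ^ 6 * p ^ 12 = p ^ 6" "p ^ 12 * u ^ 12 = 1" "u ^ 12 * p ^ 12 = 1"
    by (simp_all add: u_eq p0 field_simps p_merge)
  then show ?thesis by (simp add: opX_def wt_nat)
qed

lemma opX_21: "opX (2, 1) x = vec6 (p\<^sup>2 * (x $ A0 + \<kappa> * x $ A1)) (p\<^sup>2 * x $ A1)
    (p ^ 4 * x $ B0) (p ^ 4 * x $ B1) (p\<^sup>2 * x $ C + \<kappa> * p\<^sup>2 * x $ D) (u\<^sup>2 * x $ D)"
proof -
  have "u ^ 4 * p ^ 6 = p\<^sup>2" "p ^ 8 * u ^ 6 = p\<^sup>2" "u ^ 8 * p ^ 6 = u\<^sup>2"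
    by (simp_all add: u_eq p0 field_simps p_merge)
  moreover have "h * (p\<^sup>2 - u\<^sup>2) = \<kappa> * p\<^sup>2"
  proof -
    have "h * (p\<^sup>2 - u\<^sup>2) = u\<^sup>2 * (h * (p ^ 4 - 1))"
      by (simp add: u_eq p0 field_simps p_merge)
    also have "\<dots> = \<kappa> * p\<^sup>2"
      unfolding h_eq \<kappa>_def by (simp add: u_eq p0 field_simps p_merge)
    finally show ?thesis .
  qed
  ultimately show ?thesis by (simp add: opX_def wt_nat)
qed

lemma opX_11: "opX (1, 1) x = vec6 (p ^ 4 * x $ A0) (p ^ 4 * x $ A1)
    (p\<^sup>2 * (x $ B0 + \<kappa> * x $ B1)) (p\<^sup>2 * x $ B1)
    (u\<^sup>2 * x $ C - \<kappa> * p\<^sup>2 * x $ D) (p\<^sup>2 * x $ D)"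
proof -
  have "u\<^sup>2 * p ^ 6 = p ^ 4" "p ^ 4 * u ^ 6 = u\<^sup>2" "u ^ 4 * p ^ 6 = p\<^sup>2"
    by (simp_all add: u_eq p0 field_simps p_merge)
  moreover have "h * (u\<^sup>2 - p\<^sup>2) = - (\<kappa> * p\<^sup>2)"
  proof -
    have "h * (u\<^sup>2 - p\<^sup>2) = - (u\<^sup>2 * (h * (p ^ 4 - 1)))"
      by (simp add: u_eq p0 field_simps p_merge)
    also have "\<dots> = - (\<kappa> * p\<^sup>2)"
      unfolding h_eq \<kappa>_def by (simp add: u_eq p0 field_simps p_merge)
    finally show ?thesis .
  qed
  ultimately show ?thesis by (simp add: opX_def wt_nat)
qed

lemma opX_10: "opX (1, 0) x = vec6 (u\<^sup>2 * (x $ A0 + \<kappa> * x $ A1)) (u\<^sup>2 * x $ A1)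
    (p\<^sup>2 * (x $ B0 - \<kappa> * x $ B1)) (p\<^sup>2 * x $ B1)
    (p ^ 4 * x $ C + \<kappa> * (p ^ 4 + 1) * x $ D) (u ^ 4 * x $ D)"
proof -
  have "h * (p ^ 4 - u ^ 4) = \<kappa> * (p ^ 4 + 1)"
  proof -
    have "h * (p ^ 4 - u ^ 4) = u ^ 4 * (p ^ 4 + 1) * (h * (p ^ 4 - 1))"
      by (simp add: u_eq p0 field_simps p_merge)
    also have "\<dots> = \<kappa> * (p ^ 4 + 1)"
      unfolding h_eq \<kappa>_def by (simp add: u_eq p0 field_simps p_merge)
    finally show ?thesis .
  qed
  then show ?thesis by (simp add: opX_def wt_nat)
qed

lemma opX_01: "opX (0, 1) x = vec6 (p ^ 6 * (x $ A0 - \<kappa> * x $ A1)) (p ^ 6 * x $ A1)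
    (x $ B0 + 2 * \<kappa> * x $ B1) (x $ B1)
    (u ^ 6 * x $ C + h * (u ^ 6 - p ^ 6) * x $ D) (p ^ 6 * x $ D)"
  by (simp add: opX_def wt_nat vec6_eq_iff)

lemma Bernstein_invariant1: "opX (3, 2) (opT N1 x) = opT N1 (opX (3, 2) x)"
  by (simp add: opX_32 vec6_eq_iff algebra_simps)

lemma Bernstein_invariant2: "opX (2, 1) (opT N2 x) = opT N2 (opX (2, 1) x)"
  by (simp add: opX_21 vec6_eq_iff \<kappa>_def e_def) (simp add: u_eq p0 field_simps p_merge)

lemma Bernstein_fundamental1:
  "opX (2, 1) (opT N1 x) = opT N1 (opX (1, 1) x) + \<kappa> *s opX (2, 1) x"
proof -
  have 1: "g * p ^ 4 = g * p\<^sup>2 + \<kappa> * p ^ 4"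
    unfolding \<kappa>_def g_def by (simp add: u_eq p0 field_simps p_merge)
  have 2: "m * p ^ 4 = m * p\<^sup>2 + g * \<kappa> * p\<^sup>2"
    unfolding \<kappa>_def g_def m_def by (simp add: u_eq p0 field_simps p_merge)
  (* one identity for each of the coordinates B0, A0, A1 and B1 *)
  have "p ^ 4 * (a * a0 + b * m * a1 + g * b0 + m * b1) =
      a * (p ^ 4 * a0) + b * m * (p ^ 4 * a1) + g * (p\<^sup>2 * (b0 + \<kappa> * b1)) + m * (p\<^sup>2 * b1) +
      \<kappa> * (p ^ 4 * b0)" for a b a0 a1 b0 b1
  proof -
    have "p ^ 4 * (a * a0 + b * m * a1 + g * b0 + m * b1) =
        a * (p ^ 4 * a0) + b * m * (p ^ 4 * a1) + (g * p ^ 4) * b0 + (m * p ^ 4) * b1"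
      by (simp add: algebra_simps)
    then show ?thesis
      unfolding 1 2 by (simp add: algebra_simps)
  qed
  moreover have "p\<^sup>2 * ((\<kappa> - g) * a0 - m * a1 + b0 + \<kappa> * ((\<kappa> - g) * a1 + b1)) =
      (\<kappa> - g) * (p ^ 4 * a0) - m * (p ^ 4 * a1) + p\<^sup>2 * (b0 + \<kappa> * b1) + \<kappa> * (p\<^sup>2 * (a0 + \<kappa> * a1))"
    for a0 a1 b0 b1
  proof -
    have "(\<kappa> - g) * (p ^ 4 * a0) - m * (p ^ 4 * a1) = \<kappa> * (p ^ 4 * a0) - (g * p ^ 4) * a0 - (m * p ^ 4) * a1"
      by (simp add: algebra_simps)
    then show ?thesis
      unfolding 1 2 by (simp add: algebra_simps)
  qed
  moreover have "p\<^sup>2 * ((\<kappa> - g) * a1 + b1) = (\<kappa> - g) * (p ^ 4 * a1) + p\<^sup>2 * b1 + \<kappa> * (p\<^sup>2 * a1)" for a1 b1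
  proof -
    have "(\<kappa> - g) * (p ^ 4 * a1) = \<kappa> * (p ^ 4 * a1) - (g * p ^ 4) * a1"
      by (simp add: algebra_simps)
    then show ?thesis
      unfolding 1 by (simp add: algebra_simps)
  qed
  moreover have "p ^ 4 * (((\<kappa> - g) * g + 1) * a1 + g * b1) =
      ((\<kappa> - g) * g + 1) * (p ^ 4 * a1) + g * (p\<^sup>2 * b1) + \<kappa> * (p ^ 4 * b1)" for a1 b1
  proof -
    have "p ^ 4 * (((\<kappa> - g) * g + 1) * a1 + g * b1) =
        ((\<kappa> - g) * g + 1) * (p ^ 4 * a1) + (g * p ^ 4) * b1"
      by (simp add: algebra_simps)
    then show ?thesis
      unfolding 1 by (simp add: algebra_simps)
  qed
  ultimately show ?thesis
    by (simp add: opX_11 opX_21 vec6_eq_iff) (simp add: algebra_simps)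
qed

lemma Bernstein_fundamental2:
  "opX (1, 1) (opT N2 x) = opT N2 (opX (1, 0) x) + \<kappa> *s opX (1, 1) x"
  by (simp add: opX_10 opX_11 vec6_eq_iff \<kappa>_def e_def) (simp add: u_eq p0 field_simps p_merge)

definition cyc :: vec6 where "cyc = vec6 1 0 0 0 0 0"

lemma opT_cyc: "opT N2 cyc = p ^ 3 *s cyc"
  by (simp add: cyc_def vec6_eq_iff)

lemma opX_cyc: "opX l cyc = wt (u\<^sup>2) (p ^ 6) l *s cyc"
  by (simp add: cyc_def opX_def vec6_eq_iff)

text \<open>In the induced module this holds because \<open>w = T\<^sub>1T\<^sub>2T\<^sub>1T\<^sub>2T\<^sub>1 v\<close> satisfies \<open>T\<^sub>2w = T\<^sub>1T\<^sub>2T\<^sub>1T\<^sub>2T\<^sub>1 (T\<^sub>2v)\<close> by the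
  braid relation. In the explicit module it is the one instance of the braid relation that is
  verified by computation; the general relation is deduced from it.\<close>

lemma opT_longest_cyc:
  defines "w \<equiv> opT N1 (opT N2 (opT N1 (opT N2 (opT N1 cyc))))"
  shows "opT N2 w = p ^ 3 *s w"
proof -
  define a where "a = \<kappa> - g"
  define c where "c = a * g + 1"
  define b where "b = p ^ 3 * a + m + \<kappa> * g"
  define B where "B = p ^ 6 * a\<^sup>2 + c + (\<kappa> - 2 * g) * m * p ^ 3 + g\<^sup>2 + m * b"
  have a: "a = - (p + u + u ^ 3)"
    by (simp add: a_def \<kappa>_def g_def)
  have 1: "opT N1 cyc = vec6 a 0 c 0 0 0"
    by (simp add: cyc_def vec6_eq_iff a_def c_def)
  have 2: "opT N2 (opT N1 cyc) = vec6 (p ^ 3 * a) 0 0 c 0 0"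
    unfolding 1 by (simp add: vec6_eq_iff)
  have 3: "opT N1 (opT N2 (opT N1 cyc)) =
      vec6 (p ^ 3 * a\<^sup>2) c ((p ^ 3 * a + m) * c) (g * c) 0 0"
    unfolding 2 by (simp add: vec6_eq_iff power2_eq_square a_def c_def algebra_simps)
  have 4: "opT N2 (opT N1 (opT N2 (opT N1 cyc))) =
      vec6 (p ^ 6 * a\<^sup>2 + c) (p ^ 3 * c) (g * c) (b * c) c 0"
    unfolding 3 by (simp add: vec6_eq_iff b_def algebra_simps)
  (* T_2 multiplies x by p^3 if the coordinates satisfy A1 = e D, B1 = p^3 B0 and C = 0. *)
  have w: "w $ A1 = c * (p ^ 3 * a + b)" "w $ B1 = c * (c * p ^ 3 + g * b)"
      "w $ C = 0" "w $ D = c"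
    unfolding w_def 4 by (simp_all add: a_def c_def algebra_simps)
  have "w $ B0 = c * (p ^ 6 * a\<^sup>2 + c) + (\<kappa> - 2 * g) * m * (p ^ 3 * c) + g * (g * c) + m * (b * c)"
    unfolding w_def 4 by (simp add: a_def c_def)
  then have "w $ B0 = c * B"
    by (simp add: B_def power2_eq_square algebra_simps)
  moreover have "p ^ 3 * a + b = e"
    unfolding b_def a \<kappa>_def g_def m_def e_def by (simp add: u_eq p0 field_simps p_merge)
  moreover have "c * p ^ 3 + g * b = p ^ 3 * B"
  proof -
    have c: "c = 1 - m"
      unfolding c_def a g_def m_def
      by (simp add: u_eq p0 field_simps p_merge)
    have b: "b = p ^ 6 + p ^ 4 + 2 * p\<^sup>2 + 1 + u\<^sup>2"
      unfolding b_def a \<kappa>_def g_def m_def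
      by (simp add: u_eq p0 field_simps p_merge)
    show ?thesis
      unfolding B_def c b a \<kappa>_def g_def m_def power2_eq_square
      by (simp add: u_eq p0 field_simps p_merge)
  qed
  moreover have "c * B + \<kappa> * (c * (p ^ 3 * B)) = p ^ 3 * (c * (p ^ 3 * B))"
  proof -
    have "1 + \<kappa> * p ^ 3 = p ^ 3 * p ^ 3"
      unfolding \<kappa>_def by (simp add: u_eq p0 field_simps)
    then have "(1 + \<kappa> * p ^ 3) * (c * B) = p ^ 3 * p ^ 3 * (c * B)"
      by simp
    then show ?thesis
      by (simp add: algebra_simps)
  qed
  ultimately show ?thesis
    using w by (simp add: vec6_eq_iff)
qed

subsection \<open>Simplicity\<close>

definition stable :: "vec6 set \<Rightarrow> bool" where
  "stable U \<longleftrightarrow> (\<forall>x\<in>U. \<forall>y\<in>U. x + y \<in> U) \<and> (\<forall>c. \<forall>x\<in>U. c *s x \<in> U) \<and>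
     (\<forall>i. \<forall>x\<in>U. opT i x \<in> U) \<and> (\<forall>l. \<forall>x\<in>U. opX l x \<in> U)"

text \<open>Any nonzero vector can be moved by \<open>T\<^sub>1\<close> and \<open>T\<^sub>2\<close> to one with a component in the generalised weight
  space of \<open>t\<close>. The projection to this space is a polynomial in \<open>X\<close> at \<open>\<alpha>\<^sub>2\<close>, which has the eigenvalue 1
  there and \<open>p\<^sup>6\<close> or \<open>p\<^bsup>-6\<^esup>\<close> elsewhere. It leads to the eigenvector \<open>B0\<close>, from which the other basis
  vectors are reached one after the other.\<close>

lemma stable_imp_everything:
  assumes U: "stable U" and v: "v \<in> U" "v \<noteq> 0"
    and p6: "p ^ 6 \<noteq> 1" "p ^ 6 \<noteq> - 1" and p8: "p ^ 8 \<noteq> 1" and p10: "p ^ 10 \<noteq> 1"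
  shows "x \<in> U"
proof -
  have add: "x + y \<in> U" if "x \<in> U" "y \<in> U" for x y using U that by (simp add: stable_def)
  have scale: "c *s x \<in> U" if "x \<in> U" for c x using U that by (simp add: stable_def)
  have T: "opT i x \<in> U" if "x \<in> U" for i x using U that by (simp add: stable_def)
  have X: "opX l x \<in> U" if "x \<in> U" for l x using U that unfolding stable_def by blast
  have diff: "x - c *s y \<in> U" if "x \<in> U" "y \<in> U" for x y c
    using add [OF that(1) scale [OF that(2), of "- c"]] by simp
  have unscale: "x \<in> U" if "c *s x \<in> U" "c \<noteq> 0" for c x
    using scale [OF that(1), of "inverse c"] that(2) by simp
  have \<kappa>: "\<kappa> \<noteq> 0"
  proof
    assume "\<kappa> = 0"
    then have "p ^ 3 * p ^ 3 = u ^ 3 * p ^ 3" by (simp add: \<kappa>_def)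
    also have "\<dots> = 1" by (simp add: u_eq p0 field_simps)
    finally show False using p6 by simp
  qed
  (* the B0-coordinate of T_1 A0; it vanishes iff the intertwiner at t is singular *)
  define \<gamma> where "\<gamma> = (\<kappa> - g) * g + 1"
  have \<gamma>: "\<gamma> \<noteq> 0"
  proof
    assume "\<gamma> = 0"
    moreover have "- (p ^ 4 * (p\<^sup>2 - 1) * \<gamma>) = (p\<^sup>2 + 1) * (p ^ 8 - 1)"
      unfolding \<gamma>_def \<kappa>_def g_def by (simp add: u_eq p0 field_simps p_merge)
    moreover have "p\<^sup>2 + 1 \<noteq> 0"
    proof
      assume "p\<^sup>2 + 1 = 0"
      then have "(p\<^sup>2)\<^sup>2 = 1" by (simp add: add_eq_0_iff2)
      then have "p ^ 4 = 1" by simp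
      with p4 show False by simp
    qed
    ultimately show False using p8 by simp
  qed
  (* the C-coordinate of T_1 (D - h C), which plays the same role at s_2 t' *)
  define \<delta> where "\<delta> = 1 + h * (\<kappa> - h)"
  have \<delta>: "\<delta> \<noteq> 0"
  proof
    assume "\<delta> = 0"
    then have "0 = (p ^ 4 - 1)\<^sup>2 * \<delta>" by simp
    also have "\<dots> = (p ^ 4 - 1)\<^sup>2 + h * (p ^ 4 - 1) * (\<kappa> * (p ^ 4 - 1) - h * (p ^ 4 - 1))"
      by (simp add: \<delta>_def power2_eq_square algebra_simps)
    also have "\<dots> = (p ^ 4 - 1)\<^sup>2 + p * (p ^ 6 - 1) * (\<kappa> * (p ^ 4 - 1) - p * (p ^ 6 - 1))"
      by (simp only: h_eq)
    finally have "p\<^sup>2 * ((p ^ 4 - 1)\<^sup>2 + p * (p ^ 6 - 1) * (\<kappa> * (p ^ 4 - 1) - p * (p ^ 6 - 1))) = 0"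
      by simp
    moreover have "p\<^sup>2 * ((p ^ 4 - 1)\<^sup>2 + p * (p ^ 6 - 1) * (\<kappa> * (p ^ 4 - 1) - p * (p ^ 6 - 1)))
        = - (p ^ 10 - 1) * (p\<^sup>2 - 1)"
      unfolding \<kappa>_def power2_eq_square by (simp add: u_eq p0 field_simps p_merge)
    ultimately have "(p ^ 10 - 1) * (p\<^sup>2 - 1) = 0"
      by (simp only: minus_mult_minus mult_minus_left neg_equal_0_iff_equal)
    then have "(p\<^sup>2)\<^sup>2 = 1" using p10 p0 by simp
    then have "p ^ 4 = 1" by simp
    with p4 show False by simp
  qed
  have e: "p ^ 3 + u ^ 3 \<noteq> 0"
  proof
    assume "p ^ 3 + u ^ 3 = 0"
    then have "p ^ 3 = - (u ^ 3)" by (simp add: eq_neg_iff_add_eq_0)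
    then have "p ^ 3 * p ^ 3 = - (u ^ 3 * p ^ 3)" by (metis mult_minus_left)
    also have "\<dots> = - 1" by (simp add: u_eq p0 field_simps)
    finally show False using p6 by simp
  qed
  (* X at alpha_2 minus the scalar c *)
  define Z where "Z c x = opX (0, 1) x - c *s x" for c x
  have Z: "Z c x = vec6 ((p ^ 6 - c) * x $ A0 - p ^ 6 * \<kappa> * x $ A1) ((p ^ 6 - c) * x $ A1)
      ((1 - c) * x $ B0 + 2 * \<kappa> * x $ B1) ((1 - c) * x $ B1)
      ((u ^ 6 - c) * x $ C + h * (u ^ 6 - p ^ 6) * x $ D) ((p ^ 6 - c) * x $ D)" for c x
    by (simp add: Z_def opX_01 vec6_eq_iff algebra_simps)
  have ZU: "Z c x \<in> U" if "x \<in> U" for c x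
    unfolding Z_def by (intro diff X that)
  have u6: "u ^ 6 \<noteq> 1"
  proof
    assume "u ^ 6 = 1"
    then have "p ^ 6 = 1" by (simp add: u_eq p0 field_simps)
    with p6 show False by simp
  qed
  have B0_if_B: "vec6 0 0 1 0 0 0 \<in> U" if x: "x \<in> U" "x $ B0 \<noteq> 0 \<or> x $ B1 \<noteq> 0" for x
  proof -
    (* p^6 is a double root because of the Jordan block at t'; it is also the eigenvalue of s_1 s_2 t'. *)
    define w where "w = Z (u ^ 6) (Z (p ^ 6) (Z (p ^ 6) x))"
    have w: "w \<in> U" unfolding w_def by (intro ZU x)
    define s where "s = (1 - u ^ 6) * ((1 - p ^ 6) * (1 - p ^ 6))"
    have s: "s \<noteq> 0" using p6 u6 by (simp add: s_def)
    obtain b where w_eq: "w = vec6 0 0 b (s * x $ B1) 0 0" "x $ B1 = 0 \<Longrightarrow> b = s * x $ B0"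
      unfolding w_def Z by (simp add: s_def vec6_eq_iff)
    show ?thesis
    proof (cases "x $ B1 = 0")
      case True
      then have "w = (s * x $ B0) *s vec6 0 0 1 0 0 0"
        by (simp add: w_eq vec6_eq_iff)
      moreover have "s * x $ B0 \<noteq> 0" using s x True by simp
      ultimately show ?thesis using unscale w by metis
    next
      case False
      have "Z 1 w = (2 * \<kappa> * (s * x $ B1)) *s vec6 0 0 1 0 0 0"
        unfolding Z w_eq by (simp add: vec6_eq_iff)
      moreover have "2 * \<kappa> * (s * x $ B1) \<noteq> 0" using s False \<kappa> by simp
      ultimately show ?thesis using unscale ZU w by metis
    qed
  qed
  have B0_if_A: "vec6 0 0 1 0 0 0 \<in> U" if x: "x \<in> U" "x $ A0 \<noteq> 0 \<or> x $ A1 \<noteq> 0" for x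
  proof (cases "x $ B0 \<noteq> 0 \<or> x $ B1 \<noteq> 0")
    case True
    with x show ?thesis by (intro B0_if_B)
  next
    case False
    with x(2) \<gamma> have "opT N1 x $ B0 \<noteq> 0 \<or> opT N1 x $ B1 \<noteq> 0"
      by (auto simp flip: \<gamma>_def)
    then show ?thesis by (intro B0_if_B [OF T [OF x(1)]])
  qed
  have B0: "vec6 0 0 1 0 0 0 \<in> U"
  proof (cases "v $ A0 \<noteq> 0 \<or> v $ A1 \<noteq> 0 \<or> v $ B0 \<noteq> 0 \<or> v $ B1 \<noteq> 0")
    case True
    then show ?thesis using B0_if_A B0_if_B v(1) by blast
  next
    case False
    have he: "e = (p ^ 3 + u ^ 3) * h"
    proof -
      have "e * (p ^ 4 - 1) = (p ^ 3 + u ^ 3) * (h * (p ^ 4 - 1))"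
        unfolding h_eq e_def by (simp add: u_eq p0 field_simps p_merge)
      then show ?thesis using p4 by simp
    qed
    (* T_2 kills the A0-coordinate of v only if v is a multiple of D - h C, the weight vector
       of s_1 s_2 t'; T_1 moves that one off its line. *)
    have "opT N2 v $ A0 \<noteq> 0 \<or> opT N2 (opT N1 v) $ A0 \<noteq> 0"
    proof (rule ccontr)
      assume "\<not> ?thesis"
      then have "(p ^ 3 + u ^ 3) * (v $ C + h * v $ D) = 0"
          "(p ^ 3 + u ^ 3) * (v $ D + h * (v $ C + \<kappa> * v $ D)) = 0"
        using False by (simp_all add: he algebra_simps)
      then have 1: "v $ C = - h * v $ D" and 2: "v $ D + h * (v $ C + \<kappa> * v $ D) = 0"
        using e by (simp_all add: eq_neg_iff_add_eq_0)
      from 2 have "\<delta> * v $ D = 0"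
        unfolding 1 \<delta>_def by (simp add: algebra_simps)
      then have "v $ D = 0" using \<delta> by simp
      with 1 False v(2) show False by (simp add: vec6_eq_iff)
    qed
    then show ?thesis using B0_if_A T v(1) by blast
  qed
  have B1: "vec6 0 0 0 1 0 0 \<in> U"
  proof -
    have "vec6 0 0 0 1 0 0 = opT N2 (vec6 0 0 1 0 0 0)" by (simp add: vec6_eq_iff)
    then show ?thesis using T B0 by metis
  qed
  have A0: "vec6 1 0 0 0 0 0 \<in> U"
  proof -
    have "vec6 1 0 0 0 0 0 = opT N1 (vec6 0 0 1 0 0 0) - g *s vec6 0 0 1 0 0 0"
      by (simp add: vec6_eq_iff)
    then show ?thesis using diff T B0 by metis
  qed
  have A1: "vec6 0 1 0 0 0 0 \<in> U"
  proof -
    have "vec6 0 1 0 0 0 0 = opT N1 (vec6 0 0 0 1 0 0) - g *s vec6 0 0 0 1 0 0 - m *s vec6 0 0 1 0 0 0"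
      by (simp add: vec6_eq_iff)
    then show ?thesis using diff T B0 B1 by metis
  qed
  have C: "vec6 0 0 0 0 1 0 \<in> U"
  proof -
    have "vec6 0 0 0 0 1 0 = opT N2 (vec6 0 1 0 0 0 0) - p ^ 3 *s vec6 0 1 0 0 0 0 - 1 *s vec6 1 0 0 0 0 0"
      by (simp add: vec6_eq_iff)
    then show ?thesis using diff T A0 A1 by metis
  qed
  have D: "vec6 0 0 0 0 0 1 \<in> U"
  proof -
    have "vec6 0 0 0 0 0 1 = opT N1 (vec6 0 0 0 0 1 0)" by (simp add: vec6_eq_iff)
    then show ?thesis using T C by metis
  qed
  have "x = x $ A0 *s vec6 1 0 0 0 0 0 + x $ A1 *s vec6 0 1 0 0 0 0 + x $ B0 *s vec6 0 0 1 0 0 0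
     + x $ B1 *s vec6 0 0 0 1 0 0 + x $ C *s vec6 0 0 0 0 1 0 + x $ D *s vec6 0 0 0 0 0 1"
    by (simp add: vec6_eq_iff)
  moreover have "\<dots> \<in> U"
    by (intro add scale A0 A1 B0 B1 C D)
  ultimately show ?thesis by simp
qed

end

section \<open>The free algebra\<close>

lemma FC_mult: "FC a * FC b = FC (a * b)" by (simp add: FC_def mult_single)
lemma FC_add: "FC (a + b) = FC a + FC b" by (simp add: FC_def single_add)
lemma FC_0 [simp]: "FC 0 = 0" by (simp add: FC_def)
lemma FC_1 [simp]: "FC 1 = 1" by (simp add: FC_def)
lemma FC_commute: "FC c * x = x * FC c"
  by (induction x rule: poly_mapping_add_induct)
     (simp_all add: FC_def mult_single distrib_left distrib_right mult.commute)

definition gen_alg :: "gen \<Rightarrow> falg" where "gen_alg a = Poly_Mapping.single (Word [a]) 1"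

lemma gen_alg_simps [simp]: "gen_alg (GT i) = FT i" "gen_alg (GX l) = FX l"
  by (simp_all add: gen_alg_def FT_def FX_def)

lemma falg_induct [case_names one mult scale add]:
  assumes one: "P 1" and mult: "\<And>a x. P x \<Longrightarrow> P (gen_alg a * x)"
    and scale: "\<And>c x. P x \<Longrightarrow> P (FC c * x)" and add: "\<And>x y. P x \<Longrightarrow> P y \<Longrightarrow> P (x + y)"
  shows "P x"
proof (induction x rule: poly_mapping_add_induct)
  case zero
  show ?case using scale [OF one, of 0] by simp
next
  case (single w c)
  have "P (Poly_Mapping.single (Word ls) 1)" for ls
  proof (induction ls)
    case Nil
    show ?case using one by (simp add: zero_word_def flip: single_one)
  next
    case (Cons a ls)
    from mult [OF this, of a] show ?case by (simp add: gen_alg_def mult_single plus_word_def)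
  qed
  from scale [OF this, of c "letters w"] show ?case by (simp add: FC_def mult_single)
qed (rule add)

section \<open>The action of the free algebra and the Bernstein relation\<close>

context weight_parameter
begin

declare opT.simps [simp del]

sublocale lat: linear_action opX
  by unfold_locales (simp_all add: opX_0 opX_plus opX_add opX_scale)

definition gact :: "gen \<Rightarrow> vec6 \<Rightarrow> vec6" where
  "gact a = (case a of GT i \<Rightarrow> opT i | GX l \<Rightarrow> opX l)"

lemma gact_simps [simp]: "gact (GT i) = opT i" "gact (GX l) = opX l"
  by (simp_all add: gact_def)

lemma gact_linear: "gact a (x + y) = gact a x + gact a y" "gact a (c *s x) = c *s gact a x"
  by (cases a; simp add: opT_add opX_add opT_scale opX_scale)+

definition wact :: "word \<Rightarrow> vec6 \<Rightarrow> vec6" where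
  "wact w = foldr gact (letters w)"

sublocale word: linear_action wact
proof
  fix v w :: word and x y :: vec6 and c :: complex
  show "wact 0 x = x" "wact (v + w) x = wact v (wact w x)"
    by (simp_all add: wact_def zero_word_def plus_word_def)
  have "foldr gact ls (x + y) = foldr gact ls x + foldr gact ls y"
       "foldr gact ls (c *s x) = c *s foldr gact ls x" for ls
    by (induction ls) (simp_all add: gact_linear)
  then show "wact w (x + y) = wact w x + wact w y" "wact w (c *s x) = c *s wact w x"
    by (simp_all add: wact_def)
qed

abbreviation act :: "falg \<Rightarrow> vec6 \<Rightarrow> vec6" where "act \<equiv> word.lift"
abbreviation actX :: "(lattice \<Rightarrow>\<^sub>0 complex) \<Rightarrow> vec6 \<Rightarrow> vec6" where "actX \<equiv> lat.lift"

lemma act_FC [simp]: "act (FC c) x = c *s x"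
  by (simp add: FC_def word.A_zero)

lemma act_gens [simp]: "act (FT i) x = opT i x" "act (FX l) x = opX l x"
  by (simp_all add: FT_def FX_def wact_def)

lemma act_FX_lin: "act (FX_lin f) x = actX f x"
  by (simp add: FX_lin_def word.lift_sum word.lift_mult lat.lift_def)

lemma srefl_add: "srefl i (l + n) = srefl i l + srefl i n"
  by (cases l; cases n; cases i) (simp_all add: srefl_def)

lemma srefl_minus: "srefl i (- l) = - srefl i l"
  by (cases l; cases i) (simp_all add: srefl_def)

text \<open>The Bernstein relation for one lattice vector \<open>\<lambda>\<close>. Both \<open>X\<^sup>\<lambda>T\<^sub>i - T\<^sub>iX\<^bsup>s\<lambda>\<^esup>\<close> and the fraction are twisted
  derivations in \<open>\<lambda>\<close>, so that the vectors for which the relation holds form a subgroup, and generators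
  of the lattice suffice.\<close>

definition bernstein_at :: "node \<Rightarrow> lattice \<Rightarrow> bool" where
  "bernstein_at i l \<longleftrightarrow> (\<exists>f. f * (1 - eX (- sroot i)) = eX l - eX (srefl i l) \<and>
     (\<forall>x. opX l (opT i x) = opT i (opX (srefl i l) x) + \<kappa> *s actX f x))"

lemma actX_eX [simp]: "actX (eX l) x = opX l x"
  by (simp add: eX_def)

lemma bernstein_at_add:
  assumes "bernstein_at i l" "bernstein_at i n"
  shows "bernstein_at i (l + n)"
proof -
  from assms obtain f g where
    f: "f * (1 - eX (- sroot i)) = eX l - eX (srefl i l)"
      "\<And>x. opX l (opT i x) = opT i (opX (srefl i l) x) + \<kappa> *s actX f x" and
    g: "g * (1 - eX (- sroot i)) = eX n - eX (srefl i n)"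
      "\<And>x. opX n (opT i x) = opT i (opX (srefl i n) x) + \<kappa> *s actX g x"
    unfolding bernstein_at_def by blast
  have "(eX l * g + f * eX (srefl i n)) * (1 - eX (- sroot i)) =
      eX l * (g * (1 - eX (- sroot i))) + f * (1 - eX (- sroot i)) * eX (srefl i n)"
    by (simp add: algebra_simps)
  also have "\<dots> = eX (l + n) - eX (srefl i (l + n))"
    unfolding f g by (simp add: algebra_simps eX_mult srefl_add)
  finally have "(eX l * g + f * eX (srefl i n)) * (1 - eX (- sroot i)) = eX (l + n) - eX (srefl i (l + n))" .
  moreover have "opX (l + n) (opT i x) =
      opT i (opX (srefl i (l + n)) x) + \<kappa> *s actX (eX l * g + f * eX (srefl i n)) x" for x
    by (simp add: opX_plus srefl_add f g opX_add opX_scale lat.lift_plus lat.lift_mult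
        vec.scale_right_distrib)
  ultimately show ?thesis unfolding bernstein_at_def by blast
qed

lemma bernstein_at_minus:
  assumes "bernstein_at i l"
  shows "bernstein_at i (- l)"
proof -
  from assms obtain f where
    f: "f * (1 - eX (- sroot i)) = eX l - eX (srefl i l)"
      "\<And>x. opX l (opT i x) = opT i (opX (srefl i l) x) + \<kappa> *s actX f x"
    unfolding bernstein_at_def by blast
  have "- (eX (- l) * f * eX (- srefl i l)) * (1 - eX (- sroot i)) =
      - (eX (- l) * (f * (1 - eX (- sroot i))) * eX (- srefl i l))"
    by (simp only: mult_ac minus_mult_left)
  also have "\<dots> = eX (- l) - eX (srefl i (- l))"
    unfolding f by (simp add: algebra_simps eX_mult srefl_minus)
  finally have 1: "- (eX (- l) * f * eX (- srefl i l)) * (1 - eX (- sroot i)) = eX (- l) - eX (srefl i (- l))" .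
  have canc: "opX (- n) (opX n x) = x" "opX n (opX (- n) x) = x" for n x
    using opX_plus [of "- n" n x] opX_plus [of n "- n" x] by (simp_all add: opX_0)
  have "opX (- l) (opT i x) =
      opT i (opX (srefl i (- l)) x) + \<kappa> *s actX (- (eX (- l) * f * eX (- srefl i l))) x" for x
  proof -
    have "opX l (opT i (opX (- srefl i l) x)) = opT i x + \<kappa> *s actX f (opX (- srefl i l) x)"
      by (simp add: f canc)
    then have "opX (- l) (opX l (opT i (opX (- srefl i l) x))) = opX (- l) (opT i x + \<kappa> *s actX f (opX (- srefl i l) x))"
      by simp
    then show ?thesis
      by (simp add: canc srefl_minus opX_add opX_scale lat.lift_mult lat.lift_minus)
  qed
  with 1 show ?thesis unfolding bernstein_at_def by blast
qed

lemma bernstein_at_multiple: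
  assumes "bernstein_at i (a, b)"
  shows "bernstein_at i (k * a, k * b)"
proof (induction k rule: int_induct [of _ 0])
  case base
  show ?case
    using bernstein_at_add [OF assms bernstein_at_minus [OF assms]] by simp
next
  case (step1 k)
  from bernstein_at_add [OF step1(2) assms] show ?case by (simp add: algebra_simps)
next
  case (step2 k)
  from bernstein_at_add [OF step2(2) bernstein_at_minus [OF assms]] show ?case by (simp add: algebra_simps)
qed

text \<open>The lattice is generated by a vector fixed by the reflection and one whose pairing with the coroot
  is 1. For the first the fraction vanishes, for the second it is the single term \<open>X\<^sup>\<lambda>\<close>.\<close>

lemma bernstein_at_all: "bernstein_at i l"
proof (cases i)
  case N1
  have 1: "bernstein_at N1 (3, 2)"
    unfolding bernstein_at_def by (intro exI [of _ 0]) (simp add: srefl_def Bernstein_invariant1)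
  have 2: "bernstein_at N1 (2, 1)"
    unfolding bernstein_at_def
    by (intro exI [of _ "eX (2, 1)"]) (simp add: srefl_def Bernstein_fundamental1 right_diff_distrib eX_mult)
  obtain a b where "l = (a, b)" by (cases l)
  then have l: "l = ((2 * b - a) * 3, (2 * b - a) * 2) + ((2 * a - 3 * b) * 2, (2 * a - 3 * b) * 1)"
    by simp
  show ?thesis
    unfolding N1 l by (intro bernstein_at_add bernstein_at_multiple 1 2)
next
  case N2
  have 1: "bernstein_at N2 (2, 1)"
    unfolding bernstein_at_def by (intro exI [of _ 0]) (simp add: srefl_def Bernstein_invariant2)
  have 2: "bernstein_at N2 (1, 1)"
    unfolding bernstein_at_def
    by (intro exI [of _ "eX (1, 1)"]) (simp add: srefl_def Bernstein_fundamental2 right_diff_distrib eX_mult)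
  obtain a b where "l = (a, b)" by (cases l)
  then have l: "l = ((a - b) * 2, (a - b) * 1) + ((2 * b - a) * 1, (2 * b - a) * 1)"
    by simp
  show ?thesis
    unfolding N2 l by (intro bernstein_at_add bernstein_at_multiple 1 2)
qed

lemma Bernstein:
  assumes "f * (1 - eX (- sroot i)) = eX l - eX (srefl i l)"
  shows "opX l (opT i x) = opT i (opX (srefl i l) x) + \<kappa> *s actX f x"
proof -
  obtain f' where f': "f' * (1 - eX (- sroot i)) = eX l - eX (srefl i l)"
      "\<And>x. opX l (opT i x) = opT i (opX (srefl i l) x) + \<kappa> *s actX f' x"
    using bernstein_at_all unfolding bernstein_at_def by blast
  have "f = f'" by (rule fraction_unique [of _ i]) (simp add: assms f')
  then show ?thesis using f' by simp
qed

end

section \<open>Cyclic modules are spanned by six words\<close>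

fun letter :: "nat \<Rightarrow> node" where
  "letter 0 = N1"
| "letter (Suc k) = (case letter k of N1 \<Rightarrow> N2 | N2 \<Rightarrow> N1)"

text \<open>The word \<open>\<dots>T\<^sub>1T\<^sub>2T\<^sub>1\<close> of length \<open>k\<close>. For \<open>k < 6\<close> these belong to the shortest representatives of the
  cosets of \<open>\<langle>s\<^sub>2\<rangle>\<close> in \<open>W\<^sub>0\<close>.\<close>

fun Tw :: "nat \<Rightarrow> falg" where
  "Tw 0 = 1"
| "Tw (Suc k) = FT (letter k) * Tw k"

lemma letter_cases: "i = letter k \<or> i = letter (Suc k)"
  by (cases i; cases "letter k") simp_all

text \<open>The quotient of the free algebra by the left ideal \<open>L\<close> is a cyclic module whose generator \<open>v\<close>
  satisfies \<open>T\<^sub>2v = cv\<close> and \<open>X\<^sup>\<lambda>v = t(\<lambda>)v\<close>, and on which the quadratic and the Bernstein relations hold.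
  Of the braid relation only its consequence for the longest word \<open>Tw 5\<close> is required; thus the
  locale applies to the explicit module before the braid relation is known there.\<close>

locale cyclic_left_ideal =
  fixes \<kappa> c :: complex and t :: "lattice \<Rightarrow> complex" and L :: "falg set"
  assumes add: "x \<in> L \<Longrightarrow> y \<in> L \<Longrightarrow> x + y \<in> L"
    and mult: "x \<in> L \<Longrightarrow> a * x \<in> L"
    and square: "(FT i * FT i - (FC \<kappa> * FT i + 1)) * y \<in> L"
    and bernstein: "f * (1 - eX (- sroot i)) = eX l - eX (srefl i l) \<Longrightarrow>
        (FX l * FT i - (FT i * FX (srefl i l) + FC \<kappa> * FX_lin f)) * y \<in> L"
    and gen_T: "FT N2 - FC c \<in> L"
    and gen_X: "FX l - FC (t l) \<in> L"
    and longest: "(FT N2 - FC c) * Tw 5 \<in> L"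
begin

text \<open>The span of the words \<open>Tw k\<close> with \<open>k < n\<close>, modulo \<open>L\<close>.\<close>

inductive_set span :: "nat \<Rightarrow> falg set" for n where
  ideal: "x \<in> L \<Longrightarrow> x \<in> span n"
| base: "k < n \<Longrightarrow> Tw k \<in> span n"
| plus: "x \<in> span n \<Longrightarrow> y \<in> span n \<Longrightarrow> x + y \<in> span n"
| scale: "x \<in> span n \<Longrightarrow> FC a * x \<in> span n"

lemma span_zero: "0 \<in> span n"
  using span.ideal [OF mult [OF gen_T, of 0]] by simp

lemma span_cong: "x - y \<in> L \<Longrightarrow> y \<in> span n \<Longrightarrow> x \<in> span n"
  using span.plus [OF span.ideal, of "x - y" y n] by simp

lemma span_mono: "x \<in> span n \<Longrightarrow> n \<le> k \<Longrightarrow> x \<in> span k"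
  by (induction rule: span.induct) (auto intro: span.intros)

lemma span_mult:
  assumes "x \<in> span n" and "\<And>k. k < n \<Longrightarrow> a * Tw k \<in> span m"
  shows "a * x \<in> span m"
  using assms(1)
proof induction
  case (scale x b)
  then have "FC b * (a * x) \<in> span m" by (intro span.scale)
  then show ?case by (metis FC_commute mult.assoc)
qed (use assms(2) in \<open>auto intro: span.intros mult simp: distrib_left\<close>)

lemma T_span: "FT i * Tw k \<in> span (k + 2)"
proof (cases "i = letter k")
  case True
  then show ?thesis using span.base [of "Suc k" "k + 2"] by simp
next
  case False
  show ?thesis
  proof (cases k)
    case 0
    with False have "i = N2" by (cases i) simp_all
    have "FC c * Tw 0 \<in> span (k + 2)" by (intro span.scale span.base) simp
    with gen_T show ?thesis
      unfolding \<open>i = N2\<close> 0 by (intro span_cong [of "FT N2 * Tw 0" "FC c * Tw 0"]) auto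
  next
    case (Suc j)
    with False letter_cases [of i j] have i: "i = letter j" by simp
    have "FC \<kappa> * Tw (Suc j) + Tw j \<in> span (k + 2)"
      using Suc by (intro span.plus span.scale span.base) auto
    moreover have "FT i * Tw k - (FC \<kappa> * Tw (Suc j) + Tw j) \<in> L"
      using square [of i "Tw j"] unfolding Suc i
      by (simp add: left_diff_distrib distrib_right mult.assoc)
    ultimately show ?thesis by (rule span_cong [rotated])
  qed
qed

lemma FX_lin_span:
  assumes "\<And>l. FX l * x \<in> span n"
  shows "FX_lin f * x \<in> span n"
proof -
  have "(\<Sum>l\<in>S. FC (Poly_Mapping.lookup f l) * FX l) * x \<in> span n" for S
    by (induction S rule: infinite_finite_induct)
       (auto simp: span_zero distrib_right mult.assoc intro: span.plus span.scale assms)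
  then show ?thesis by (simp add: FX_lin_def)
qed

text \<open>The Bernstein relation moves \<open>X\<^sup>\<lambda>\<close> to the right past the first letter of the word, at the cost of
  terms with shorter words; at the end it meets the generator, which is a weight vector. Hence \<open>X\<close> is
  triangular with respect to word length.\<close>

lemma X_span: "FX l * Tw k \<in> span (Suc k)"
proof (induction k arbitrary: l)
  case 0
  have "FC (t l) * Tw 0 \<in> span (Suc 0)" by (intro span.scale span.base) simp
  with gen_X [of l] show ?case
    by (intro span_cong [of "FX l * Tw 0" "FC (t l) * Tw 0"]) auto
next
  case (Suc k)
  let ?i = "letter k"
  obtain f where f: "f * (1 - eX (- sroot ?i)) = eX l - eX (srefl ?i l)"
    using fraction_exists by blast
  have "FT ?i * (FX (srefl ?i l) * Tw k) \<in> span (Suc (Suc k))"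
    by (rule span_mult [OF Suc]) (auto intro: span_mono [OF T_span])
  moreover have "FC \<kappa> * (FX_lin f * Tw k) \<in> span (Suc (Suc k))"
    by (intro span.scale span_mono [OF FX_lin_span [OF Suc]]) simp
  moreover have "FX l * Tw (Suc k) -
      (FT ?i * (FX (srefl ?i l) * Tw k) + FC \<kappa> * (FX_lin f * Tw k)) \<in> L"
    using bernstein [OF f, of "Tw k"] by (simp add: algebra_simps)
  ultimately show ?case using span_cong span.plus by blast
qed

lemma T_span6: "k < 6 \<Longrightarrow> FT i * Tw k \<in> span 6"
proof -
  assume k: "k < 6"
  show ?thesis
  proof (cases "k = 5 \<and> i = N2")
    case True
    have "FC c * Tw 5 \<in> span 6" by (intro span.scale span.base) simp
    with longest True show ?thesis
      by (auto intro!: span_cong [of "FT N2 * Tw 5" "FC c * Tw 5"] simp: left_diff_distrib)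
  next
    case False
    show ?thesis
    proof (cases "k = 5")
      case True
      with False have i: "i = letter 4" by (cases i) (auto simp: eval_nat_numeral)
      have "FC \<kappa> * Tw 5 + Tw 4 \<in> span 6"
        by (intro span.plus span.scale span.base) auto
      moreover have "FT i * Tw k - (FC \<kappa> * Tw 5 + Tw 4) \<in> L"
      proof -
        have "FT (letter 4) * Tw 4 = Tw 5"
          by (simp add: eval_nat_numeral)
        with square [of i "Tw 4"] show ?thesis
          unfolding True i by (simp add: left_diff_distrib distrib_right mult.assoc)
      qed
      ultimately show ?thesis by (rule span_cong [rotated])
    next
      case False
      with k have "k + 2 \<le> 6" by simp
      then show ?thesis by (rule span_mono [OF T_span])
    qed
  qed
qed

text \<open>The six words are closed under the generators: multiplication by the first letter of a word is the
  quadratic relation, by the other letter it lengthens the word, and at the ends \<open>Tw 0\<close> and \<open>Tw 5\<close>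
  the element \<open>T\<^sub>2\<close> acts by the scalar \<open>c\<close>.\<close>

lemma span_everything: "x \<in> span 6"
proof (induction x rule: falg_induct)
  case one
  show ?case using span.base [of 0 6] by simp
next
  case (mult a x)
  have "gen_alg a * Tw k \<in> span 6" if "k < 6" for k
    using that span_mono [OF X_span, of k 6] T_span6 by (cases a) auto
  from span_mult [OF mult this] show ?case .
qed (auto intro: span.plus span.scale)

end

text \<open>An enumeration of the basis, by which the coefficients of the six words become vectors in the
  space of the explicit module; only the equality of the two dimensions matters.\<close>

fun height :: "basis \<Rightarrow> nat" where
  "height A0 = 0" | "height A1 = 1" | "height B0 = 2" | "height B1 = 3" | "height C = 4" | "height D = 5"

lemma height_surj: "k < 6 \<Longrightarrow> \<exists>i. k = height i"
proof -
  assume "k < 6"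
  then have "k \<in> {0, 1, 2, 3, 4, 5}" by auto
  then show ?thesis by (metis height.simps insertE emptyE)
qed

definition normal_form :: "vec6 \<Rightarrow> falg" where
  "normal_form c = (\<Sum>i\<in>UNIV. FC (c $ i) * Tw (height i))"

lemma normal_form_add: "normal_form (x + y) = normal_form x + normal_form y"
  by (simp add: normal_form_def FC_add distrib_right sum.distrib)

lemma normal_form_scale: "normal_form (a *s x) = FC a * normal_form x"
  by (simp add: normal_form_def sum_distrib_left mult.assoc flip: FC_mult)

lemma normal_form_axis: "normal_form (axis i 1) = Tw (height i)"
proof -
  have "normal_form (axis i 1) = (\<Sum>j\<in>UNIV. if j = i then Tw (height j) else 0)"
    unfolding normal_form_def by (rule sum.cong) (auto simp: axis_def)
  then show ?thesis by simp
qed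

lemma (in cyclic_left_ideal) congruent_normal_form: "\<exists>c. x - normal_form c \<in> L"
proof -
  from span_everything [of x] show ?thesis
  proof induction
    case (ideal x)
    then show ?case by (intro exI [of _ 0]) (simp add: normal_form_def)
  next
    case (base k)
    then obtain i where "k = height i" using height_surj by blast
    then show ?case
      using mult [OF gen_T, of 0] by (intro exI [of _ "axis i 1"]) (simp add: normal_form_axis)
  next
    case (plus x y)
    then obtain c d where "x - normal_form c \<in> L" "y - normal_form d \<in> L" by blast
    from add [OF this] show ?case
      by (intro exI [of _ "c + d"]) (simp add: normal_form_add algebra_simps)
  next
    case (scale x a)
    then obtain c where "x - normal_form c \<in> L" by blast
    from mult [OF this, of "FC a"] show ?case
      by (intro exI [of _ "a *s c"]) (simp add: normal_form_scale right_diff_distrib)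
  qed
qed

section \<open>The braid relation\<close>

text \<open>For \<open>r = p\<^sup>2\<close> and \<open>q = p\<^sup>3\<close> these conditions exclude \<open>q\<^sup>2 = 1\<close>, \<open>q\<^sup>2 = -1\<close>, \<open>r = q\<^bsup>-2\<^esup>\<close> and
  \<open>r = \<plusminus>q\<^bsup>-1\<^esup>\<close>, in this order; \<open>p\<^sup>4 \<noteq> 1\<close> excludes \<open>r = q\<^sup>2\<close> and \<open>r = \<plusminus>q\<close>.\<close>

locale generic_weight_parameter = weight_parameter +
  assumes p6: "p ^ 6 \<noteq> 1" "p ^ 6 \<noteq> - 1" and p8: "p ^ 8 \<noteq> 1" and p10: "p ^ 10 \<noteq> 1"
begin

lemma act_surj:
  assumes "v \<noteq> 0"
  shows "\<exists>y. act y v = w"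
proof -
  have "stable (range (\<lambda>y. act y v))"
    unfolding stable_def
  proof (intro conjI ballI allI)
    fix x y i l c assume "x \<in> range (\<lambda>y. act y v)"
    then obtain x' where x': "x = act x' v" by blast
    show "c *s x \<in> range (\<lambda>y. act y v)"
      by (rule image_eqI [of _ _ "FC c * x'"]) (simp_all add: x' word.lift_mult)
    show "opT i x \<in> range (\<lambda>y. act y v)"
      by (rule image_eqI [of _ _ "FT i * x'"]) (simp_all add: x' word.lift_mult)
    show "opX l x \<in> range (\<lambda>y. act y v)"
      by (rule image_eqI [of _ _ "FX l * x'"]) (simp_all add: x' word.lift_mult)
    assume "y \<in> range (\<lambda>y. act y v)"
    then obtain y' where "y = act y' v" by blast
    then show "x + y \<in> range (\<lambda>y. act y v)"
      by (intro image_eqI [of _ _ "x' + y'"]) (simp_all add: x' word.lift_plus)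
  qed
  moreover have "v \<in> range (\<lambda>y. act y v)"
    by (rule image_eqI [of _ _ 1]) simp_all
  ultimately have "w \<in> range (\<lambda>y. act y v)"
    using assms p6 p8 p10 by (rule stable_imp_everything)
  then show ?thesis by blast
qed

definition ann :: "falg set" where "ann = {y. act y cyc = 0}"

lemma act_Tw5: "act (Tw 5) cyc = opT N1 (opT N2 (opT N1 (opT N2 (opT N1 cyc))))"
  by (simp add: eval_nat_numeral word.lift_mult)

sublocale ann: cyclic_left_ideal \<kappa> "p ^ 3" "wt (u\<^sup>2) (p ^ 6)" ann
proof
  fix f i l y assume "f * (1 - eX (- sroot i)) = eX l - eX (srefl i l)"
  from Bernstein [OF this]
  show "(FX l * FT i - (FT i * FX (srefl i l) + FC \<kappa> * FX_lin f)) * y \<in> ann"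
    by (simp add: ann_def word.lift_mult word.lift_plus word.lift_diff act_FX_lin)
next
  show "(FT N2 - FC (p ^ 3)) * Tw 5 \<in> ann"
    by (simp add: ann_def word.lift_mult word.lift_diff act_Tw5 opT_longest_cyc)
qed (simp_all add: ann_def word.lift_mult word.lift_plus word.lift_diff
       opT_square opT_cyc opX_cyc)

definition orbit :: "vec6 \<Rightarrow> vec6" where "orbit c = act (normal_form c) cyc"

lemma orbit_linear: "Vector_Spaces.linear (*s) (*s) orbit"
  by unfold_locales
     (simp_all add: orbit_def normal_form_add normal_form_scale word.lift_plus word.lift_mult)

lemma cyc_nonzero: "cyc \<noteq> 0"
  by (simp add: cyc_def vec6_eq_iff)

lemma orbit_surj: "surj orbit"
proof -
  have "\<exists>c. orbit c = w" for w
  proof -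
    obtain y where "act y cyc = w" using act_surj [OF cyc_nonzero] by blast
    moreover obtain c where "y - normal_form c \<in> ann" using ann.congruent_normal_form by blast
    ultimately show ?thesis by (auto simp: ann_def orbit_def word.lift_diff)
  qed
  then show ?thesis by (metis surj_def)
qed

text \<open>Simplicity makes the six vectors \<open>T\<^sub>wv\<close> span a space of dimension six, hence they are
  independent.\<close>

lemma orbit_inj: "inj orbit"
  by (rule vec.linear_surj_imp_inj [OF orbit_linear orbit_surj])

text \<open>The vectors \<open>P k = T\<^sub>wv\<close> span, so the relation may be checked on them. There \<open>T\<^sub>1\<close> and \<open>T\<^sub>2\<close> act along
  the chain \<open>P 0, \<dots>, P 5\<close>: one of them steps up or, by the quadratic relation, down, and at both ends
  \<open>T\<^sub>2\<close> is multiplication by \<open>q\<close>.\<close>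

lemma opT_braid:
  "opT N1 (opT N2 (opT N1 (opT N2 (opT N1 (opT N2 x))))) =
   opT N2 (opT N1 (opT N2 (opT N1 (opT N2 (opT N1 x)))))" (is "?l x = ?r x")
proof -
  define P where "P k = act (Tw k) cyc" for k
  have suc: "opT (letter k) (P k) = P (Suc k)" for k
    by (simp add: P_def word.lift_mult)
  have pred: "opT (letter k) (P (Suc k)) = \<kappa> *s P (Suc k) + P k" for k
    by (simp add: suc [symmetric] opT_square)
  have q6: "p ^ 6 = \<kappa> * p ^ 3 + 1"
    unfolding \<kappa>_def by (simp add: u_eq p0 field_simps)
  have "p ^ 9 = p ^ 6 * p ^ 3"
    by simp
  then have q9: "p ^ 9 = (\<kappa> * \<kappa> + 1) * p ^ 3 + \<kappa>"
    by (simp only: q6) (simp add: algebra_simps q6)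
  have "opT N2 (P 0) = p ^ 3 *s P 0" "opT N2 (P 5) = p ^ 3 *s P 5"
    by (simp_all add: P_def opT_cyc act_Tw5 opT_longest_cyc del: Tw.simps(2))
  moreover have "opT N1 (P 0) = P 1" "opT N2 (P 1) = P 2" "opT N1 (P 2) = P 3"
      "opT N2 (P 3) = P 4" "opT N1 (P 4) = P 5"
    using suc [of 0] suc [of 1] suc [of 2] suc [of 3] suc [of 4] by (simp_all add: eval_nat_numeral)
  moreover have "opT N1 (P 1) = \<kappa> *s P 1 + P 0" "opT N2 (P 2) = \<kappa> *s P 2 + P 1"
      "opT N1 (P 3) = \<kappa> *s P 3 + P 2" "opT N2 (P 4) = \<kappa> *s P 4 + P 3" "opT N1 (P 5) = \<kappa> *s P 5 + P 4"
    using pred [of 0] pred [of 1] pred [of 2] pred [of 3] pred [of 4] by (simp_all add: eval_nat_numeral)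
  ultimately have P: "?l (P k) = ?r (P k)" if "k \<in> {0, 1, 2, 3, 4, 5}" for k
    using that
    by (elim insertE emptyE; simp add: opT_add opT_scale; simp add: vec_eq_iff q6 q9 algebra_simps)
  have "?l (P k) = ?r (P k)" if "k < 6" for k
  proof -
    from that have "k \<in> {0, 1, 2, 3, 4, 5}" by auto
    then show ?thesis by (rule P)
  qed
  moreover obtain c where "x = orbit c" using orbit_surj by (metis surj_def)
  then have "x = (\<Sum>i\<in>UNIV. c $ i *s P (height i))"
    by (simp add: orbit_def normal_form_def P_def word.lift_sum word.lift_mult)
  moreover have "height i < 6" for i by (cases i) simp_all
  moreover have "opT i (\<Sum>j\<in>S. f j) = (\<Sum>j\<in>S. opT i (f j))" for i S and f :: "basis \<Rightarrow> vec6"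
    using opT_scale [of i 0 0] by (induction S rule: infinite_finite_induct) (simp_all add: opT_add)
  ultimately show ?thesis by (simp add: opT_scale)
qed

lemma act_rels:
  assumes "y \<in> hecke_rels (p ^ 3)"
  shows "act y x = 0"
proof -
  have \<kappa>: "p ^ 3 - inverse (p ^ 3) = \<kappa>"
    unfolding \<kappa>_def by (simp add: u_eq divide_inverse power_inverse)
  from assms consider
    i where "y = FT i * FT i - (FC \<kappa> * FT i + 1)"
  | "y = FT N1 * FT N2 * FT N1 * FT N2 * FT N1 * FT N2 - FT N2 * FT N1 * FT N2 * FT N1 * FT N2 * FT N1"
  | "y = FX 0 - 1"
  | l n where "y = FX l * FX n - FX (l + n)"
  | l i f where "y = FX l * FT i - (FT i * FX (srefl i l) + FC \<kappa> * FX_lin f)"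
      "f * (1 - eX (- sroot i)) = eX l - eX (srefl i l)"
    unfolding hecke_rels_def \<kappa> by blast
  then show ?thesis
    by cases (simp_all add: word.lift_mult word.lift_plus word.lift_diff act_FX_lin
        opT_square opT_braid opX_0 opX_plus Bernstein)
qed

lemma act_ideal:
  assumes "y \<in> hecke_ideal (p ^ 3)"
  shows "act y x = 0"
proof -
  interpret R: ring free_ring by (rule ring_free_ring)
  let ?K = "{y. \<forall>x. act y x = 0}"
  have "ideal ?K free_ring"
  proof (rule idealI [OF ring_free_ring])
    show "subgroup ?K (add_monoid free_ring)"
    proof (rule R.add.subgroupI)
      fix a assume a: "a \<in> ?K"
      have "\<ominus>\<^bsub>free_ring\<^esub> a = - a"
        by (rule R.minus_equality) (simp_all add: free_ring_def)
      with a show "\<ominus>\<^bsub>free_ring\<^esub> a \<in> ?K" by (simp add: word.lift_minus)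
    qed (auto simp: free_ring_def word.lift_plus intro: exI [of _ 0])
  qed (simp_all add: free_ring_def word.lift_mult)
  then have "hecke_ideal (p ^ 3) \<subseteq> ?K"
    unfolding hecke_ideal_def by (rule R.genideal_minimal) (auto simp: act_rels)
  with assms show ?thesis by blast
qed

end

section \<open>The affine Hecke algebra and its parabolic subalgebra\<close>

definition hcls :: "complex \<Rightarrow> falg \<Rightarrow> hecke_elt" where
  "hcls q y = hecke_ideal q +>\<^bsub>free_ring\<^esub> y"

lemma hcls_gens: "HC q c = hcls q (FC c)" "HT q i = hcls q (FT i)" "HX q l = hcls q (FX l)"
  by (simp_all add: hcls_def HC_def HT_def HX_def)

lemma ideal_hecke: "ideal (hecke_ideal q) free_ring"
  unfolding hecke_ideal_def by (rule ring.genideal_ideal [OF ring_free_ring]) (simp add: free_ring_def)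

lemma free_ring_simps [simp]:
  "carrier free_ring = UNIV" "x \<otimes>\<^bsub>free_ring\<^esub> y = x * y" "x \<oplus>\<^bsub>free_ring\<^esub> y = x + y"
  "\<one>\<^bsub>free_ring\<^esub> = 1" "\<zero>\<^bsub>free_ring\<^esub> = 0"
  by (simp_all add: free_ring_def)

lemma hcls_hom: "hcls q \<in> ring_hom free_ring (hecke q)"
  unfolding hecke_def hcls_def [abs_def] by (rule ideal.rcos_ring_hom [OF ideal_hecke])

lemma hcls_simps:
  "hcls q x \<otimes>\<^bsub>hecke q\<^esub> hcls q y = hcls q (x * y)" "hcls q x \<oplus>\<^bsub>hecke q\<^esub> hcls q y = hcls q (x + y)"
  "\<one>\<^bsub>hecke q\<^esub> = hcls q 1"
  using ring_hom_mult [OF hcls_hom, of x y q] ring_hom_add [OF hcls_hom, of x y q] ring_hom_one [OF hcls_hom, of q]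
  by simp_all

lemma carrier_hecke: "carrier (hecke q) = range (hcls q)"
  by (simp add: hecke_def FactRing_def A_RCOSETS_def' hcls_def [abs_def] full_SetCompr_eq) blast

lemma hcls_eq_iff: "hcls q x = hcls q y \<longleftrightarrow> x - y \<in> hecke_ideal q"
proof -
  interpret R: ring free_ring by (rule ring_free_ring)
  have "\<ominus>\<^bsub>free_ring\<^esub> y = - y"
    by (rule R.minus_equality) simp_all
  then have "x \<ominus>\<^bsub>free_ring\<^esub> y = x - y"
    by (simp add: a_minus_def)
  then show ?thesis
    unfolding hcls_def using R.quotient_eq_iff_same_a_r_cos [OF ideal_hecke, of x y q] by simp
qed

lemma hcls_zero: "\<zero>\<^bsub>hecke q\<^esub> = hcls q 0"
proof -
  interpret H: ring "hecke q" by (rule ring_hecke)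
  have "hcls q 0 \<oplus>\<^bsub>hecke q\<^esub> hcls q 0 = hcls q 0" by (simp add: hcls_simps)
  then show ?thesis
    by (metis H.add.l_cancel_one H.zero_closed carrier_hecke rangeI)
qed

lemma hcls_minus: "\<ominus>\<^bsub>hecke q\<^esub> hcls q x = hcls q (- x)"
proof -
  interpret H: ring "hecke q" by (rule ring_hecke)
  show ?thesis
    by (rule H.minus_equality) (simp_all add: hcls_simps hcls_zero carrier_hecke)
qed

lemma rels_ideal: "y \<in> hecke_rels q \<Longrightarrow> x * y * z \<in> hecke_ideal q"
proof -
  interpret I: ideal "hecke_ideal q" free_ring by (rule ideal_hecke)
  assume "y \<in> hecke_rels q"
  then have "y \<in> hecke_ideal q"
    unfolding hecke_ideal_def using ring.genideal_self [OF ring_free_ring, of "hecke_rels q"] by auto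
  then show ?thesis using I.I_l_closed I.I_r_closed by simp
qed

definition para :: "complex \<Rightarrow> hecke_elt set" where
  "para q = carrier (hecke_sub q N2)"

lemma hecke_sub_eq: "hecke_sub q N2 = (hecke q)\<lparr>carrier := para q\<rparr>"
  by (simp add: para_def hecke_sub_def)

lemma para_eq: "para q = generate_ring (hecke q) (range (HC q) \<union> {HT q N2} \<union> range (HX q))"
  by (simp add: para_def hecke_sub_def)

lemma gens_carrier: "range (HC q) \<union> {HT q N2} \<union> range (HX q) \<subseteq> carrier (hecke q)"
  by (auto simp: hcls_gens carrier_hecke)

lemma para_subset: "para q \<subseteq> carrier (hecke q)"
  unfolding para_eq using ring.generate_ring_in_carrier [OF ring_hecke gens_carrier] by blast

lemma para_rep: "a \<in> para q \<Longrightarrow> \<exists>y. a = hcls q y"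
  using para_subset [of q] unfolding carrier_hecke by auto

lemma ring_para: "ring (hecke_sub q N2)"
  unfolding hecke_sub_eq para_eq
  by (rule ring.subring_is_ring [OF ring_hecke ring.generate_ring_is_subring [OF ring_hecke gens_carrier]])

lemma para_gens: "HC q c \<in> para q" "HT q N2 \<in> para q" "HX q l \<in> para q"
  unfolding para_eq by (auto intro: generate_ring.incl)

text \<open>Additive inverses are products with the scalar \<open>-1\<close>, which is among the generators.\<close>

lemma para_induct [consumes 1, case_names scalar T X add mult]:
  assumes "a \<in> para q"
    and "\<And>c. P (HC q c)" "P (HT q N2)" "\<And>l. P (HX q l)"
    and "\<And>a b. a \<in> para q \<Longrightarrow> b \<in> para q \<Longrightarrow> P a \<Longrightarrow> P b \<Longrightarrow> P (a \<oplus>\<^bsub>hecke q\<^esub> b)"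
    and mult: "\<And>a b. a \<in> para q \<Longrightarrow> b \<in> para q \<Longrightarrow> P a \<Longrightarrow> P b \<Longrightarrow> P (a \<otimes>\<^bsub>hecke q\<^esub> b)"
  shows "P a"
  using assms(1) unfolding para_eq
proof induction
  case one
  show ?case using assms(2) [of 1] by (simp add: hcls_simps hcls_gens)
next
  case (incl h)
  then show ?case using assms(2-4) by auto
next
  case (a_inv h)
  then have h: "h \<in> para q" "P h" by (simp_all add: para_eq)
  then obtain y where "h = hcls q y" using para_rep by blast
  moreover have "FC (-1) = -1" by (metis FC_1 FC_0 FC_add add.right_inverse add_eq_0_iff)
  ultimately have "\<ominus>\<^bsub>hecke q\<^esub> h = HC q (-1) \<otimes>\<^bsub>hecke q\<^esub> h"
    by (simp add: hcls_simps hcls_gens hcls_minus)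
  then show ?case using mult [OF para_gens(1) h(1) assms(2) h(2)] by simp
qed (use assms(5,6) in \<open>simp_all add: para_eq\<close>)

lemma left_module_smult_zero:
  assumes "left_module R M" "a \<in> carrier R"
  shows "a \<odot>\<^bsub>M\<^esub> \<zero>\<^bsub>M\<^esub> = \<zero>\<^bsub>M\<^esub>"
proof -
  interpret left_module R M by fact
  have "a \<odot>\<^bsub>M\<^esub> \<zero>\<^bsub>M\<^esub> \<oplus>\<^bsub>M\<^esub> a \<odot>\<^bsub>M\<^esub> \<zero>\<^bsub>M\<^esub> = a \<odot>\<^bsub>M\<^esub> \<zero>\<^bsub>M\<^esub>"
    using smult_r_distr [OF assms(2) M.zero_closed M.zero_closed] by simp
  then show ?thesis
    using M.add.l_cancel_one assms(2) smult_closed M.zero_closed by blast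
qed

section \<open>Induced modules\<close>

context generic_weight_parameter
begin

abbreviation q where "q \<equiv> p ^ 3"

text \<open>The action of a coset is that of any representative, because the ideal acts by zero.\<close>

definition rep :: "hecke_elt \<Rightarrow> vec6 \<Rightarrow> vec6" where
  "rep a = act (SOME y. a = hcls q y)"

lemma rep_hc [simp]: "rep (hcls q y) x = act y x"
proof -
  have "hcls q y = hcls q (SOME z. hcls q y = hcls q z)" by (rule someI_ex) blast
  then have "act (y - (SOME z. hcls q y = hcls q z)) x = 0"
    by (intro act_ideal) (simp only: hcls_eq_iff)
  then show ?thesis by (simp add: rep_def word.lift_diff)
qed

lemma para_eigenvector: "a \<in> para q \<Longrightarrow> \<exists>s. rep a cyc = s *s cyc"
proof (induction rule: para_induct)
  case (add a b)
  then obtain x y where "a = hcls q x" "b = hcls q y" using para_rep by meson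
  moreover from add(3,4) obtain s s' where "rep a cyc = s *s cyc" "rep b cyc = s' *s cyc" by blast
  ultimately have "rep (a \<oplus>\<^bsub>hecke q\<^esub> b) cyc = (s + s') *s cyc"
    by (simp only: hcls_simps rep_hc word.lift_plus vec.scale_left_distrib)
  then show ?case by blast
next
  case (mult a b)
  then obtain x y where "a = hcls q x" "b = hcls q y" using para_rep by meson
  moreover from mult(3,4) obtain s s' where "rep a cyc = s *s cyc" "rep b cyc = s' *s cyc" by blast
  ultimately have "rep (a \<otimes>\<^bsub>hecke q\<^esub> b) cyc = (s' * s) *s cyc"
    by (simp add: hcls_simps word.lift_mult word.lift_scale)
  then show ?case by blast
qed (auto simp: hcls_gens opT_cyc opX_cyc)

text \<open>The character by which the parabolic subalgebra acts on the line through \<open>cyc\<close>.\<close>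

definition chi :: "hecke_elt \<Rightarrow> complex" where "chi a = rep a cyc $ A0"

lemma chi: "a \<in> para q \<Longrightarrow> rep a cyc = chi a *s cyc"
  using para_eigenvector [of a] by (auto simp: chi_def) (simp add: cyc_def)

lemma chi_eqI: "rep a cyc = s *s cyc \<Longrightarrow> chi a = s"
  by (simp add: chi_def cyc_def)

lemma chi_hom:
  assumes "a \<in> para q" "b \<in> para q"
  shows "chi (a \<oplus>\<^bsub>hecke q\<^esub> b) = chi a + chi b" "chi (a \<otimes>\<^bsub>hecke q\<^esub> b) = chi a * chi b"
proof -
  obtain x y where ab: "a = hcls q x" "b = hcls q y" using assms [THEN para_rep] by blast
  define s s' where "s = chi a" and "s' = chi b"
  have act: "act x cyc = s *s cyc" "act y cyc = s' *s cyc"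
    using chi [OF assms(1)] chi [OF assms(2)] by (simp_all add: s_def s'_def ab)
  have "chi (a \<oplus>\<^bsub>hecke q\<^esub> b) = s + s'"
    by (rule chi_eqI) (simp only: ab hcls_simps rep_hc word.lift_plus act vec.scale_left_distrib)
  moreover have "chi (a \<otimes>\<^bsub>hecke q\<^esub> b) = s * s'"
    by (rule chi_eqI) (simp add: ab hcls_simps word.lift_mult word.lift_scale act mult.commute)
  ultimately show "chi (a \<oplus>\<^bsub>hecke q\<^esub> b) = chi a + chi b"
      "chi (a \<otimes>\<^bsub>hecke q\<^esub> b) = chi a * chi b"
    by (simp_all add: s_def s'_def)
qed

lemma chi_gens: "chi (HC q c) = c" "chi (HT q N2) = q" "chi (HX q l) = wt (u\<^sup>2) (p ^ 6) l"
    "chi (\<one>\<^bsub>hecke q\<^esub>) = 1"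
  by (rule chi_eqI; simp add: hcls_gens hcls_simps opT_cyc opX_cyc)+

text \<open>The line through \<open>cyc\<close> in the explicit module is stable under the subalgebra, which acts on it by
  \<open>chi\<close>.\<close>

lemma line_module_exists:
  "\<exists>(V :: (hecke_elt, complex) module) v. line_module q N2 q (wt (u\<^sup>2) (p ^ 6)) V v"
proof -
  define V :: "(hecke_elt, complex) module" where
    "V = \<lparr>carrier = UNIV, monoid.mult = undefined, one = undefined, ring.zero = 0, add = (+),
          smult = (\<lambda>a z. chi a * z)\<rparr>"
  have V: "carrier V = UNIV" "\<zero>\<^bsub>V\<^esub> = 0" "x \<oplus>\<^bsub>V\<^esub> y = x + y" "a \<odot>\<^bsub>V\<^esub> x = chi a * x" for a x y
    by (simp_all add: V_def)
  have "left_module (hecke_sub q N2) V"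
  proof (intro left_module.intro left_module_axioms.intro)
    show "ring (hecke_sub q N2)" by (rule ring_para)
    show "abelian_group V"
      by (rule abelian_groupI) (auto simp: V algebra_simps intro: exI [of _ "- _"])
  qed (simp_all add: hecke_sub_eq V chi_hom chi_gens algebra_simps)
  then have "line_module q N2 q (wt (u\<^sup>2) (p ^ 6)) V 1"
    by (simp add: line_module_def V chi_gens bij_betw_def inj_def)
  then show ?thesis by blast
qed

text \<open>Every element of the induced module is \<open>y \<otimes> v\<close> for some \<open>y\<close> in the free algebra. The set \<open>L\<close> of those
  \<open>y\<close> with \<open>y \<otimes> v = 0\<close> is contained in the annihilator of \<open>cyc\<close>, by the universal property of the tensor
  product. Modulo \<open>L\<close> every \<open>y\<close> is a combination of six words, and these are independent on \<open>cyc\<close>;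
  so \<open>L\<close> is that annihilator. For \<open>y \<otimes> v \<noteq> 0\<close>, simplicity of the explicit module gives a \<open>z\<close> with
  \<open>zy cyc = cyc\<close>, that is \<open>zy \<otimes> v = 1 \<otimes> v\<close>.\<close>

lemma induced_irreducible:
  fixes V :: "(hecke_elt, 'v) module"
  assumes line: "line_module q N2 q (wt (u\<^sup>2) (p ^ 6)) V v"
  shows "irreducible_module (hecke q) (induced q N2 V)"
proof -
  have V_module: "left_module ((hecke q)\<lparr>carrier := para q\<rparr>) V" and v: "v \<in> carrier V"
    and bij: "bij_betw (\<lambda>z. HC q z \<odot>\<^bsub>V\<^esub> v) UNIV (carrier V)"
    and Tv: "HT q N2 \<odot>\<^bsub>V\<^esub> v = HC q q \<odot>\<^bsub>V\<^esub> v"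
    and Xv: "\<And>l. HX q l \<odot>\<^bsub>V\<^esub> v = HC q (wt (u\<^sup>2) (p ^ 6) l) \<odot>\<^bsub>V\<^esub> v"
    using line by (auto simp: line_module_def hecke_sub_eq)
  interpret V: left_module "(hecke q)\<lparr>carrier := para q\<rparr>" V by (rule V_module)
  interpret H: ring "hecke q" by (rule ring_hecke)
  interpret tensor_product "hecke q" "para q" V
    by (intro tensor_product.intro tensor_product_axioms.intro H.ring_axioms para_subset V_module)
  have ind: "induced q N2 V = M"
    by (simp add: induced_def para_def)
  have in_H [simp]: "hcls q y \<in> carrier (hecke q)" for y by (simp add: carrier_hecke)
  define \<phi> where "\<phi> w = (THE z. w = HC q z \<odot>\<^bsub>V\<^esub> v)" for w
  have inj: "HC q z \<odot>\<^bsub>V\<^esub> v = HC q z' \<odot>\<^bsub>V\<^esub> v \<Longrightarrow> z = z'" for z z'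
    using bij by (auto simp: bij_betw_def inj_def)
  have \<phi>: "\<phi> (HC q z \<odot>\<^bsub>V\<^esub> v) = z" for z
    unfolding \<phi>_def by (rule the_equality) (auto dest: inj)
  have V_cases: "\<exists>z. w = HC q z \<odot>\<^bsub>V\<^esub> v" if "w \<in> carrier V" for w
    using bij that by (auto simp: bij_betw_def)
  have assoc: "(a \<otimes>\<^bsub>hecke q\<^esub> b) \<odot>\<^bsub>V\<^esub> w = a \<odot>\<^bsub>V\<^esub> (b \<odot>\<^bsub>V\<^esub> w)"
    if "a \<in> para q" "b \<in> para q" "w \<in> carrier V" for a b w
    using V.smult_assoc that by simp
  have ldistr: "(a \<oplus>\<^bsub>hecke q\<^esub> b) \<odot>\<^bsub>V\<^esub> w = a \<odot>\<^bsub>V\<^esub> w \<oplus>\<^bsub>V\<^esub> b \<odot>\<^bsub>V\<^esub> w"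
    if "a \<in> para q" "b \<in> para q" "w \<in> carrier V" for a b w
    using V.smult_l_distr that by simp
  have HC_mult: "HC q a \<odot>\<^bsub>V\<^esub> (HC q b \<odot>\<^bsub>V\<^esub> v) = HC q (a * b) \<odot>\<^bsub>V\<^esub> v" for a b
    using assoc [OF para_gens(1) para_gens(1) v, of a b] by (simp add: hcls_gens hcls_simps FC_mult)
  have HC_add: "HC q a \<odot>\<^bsub>V\<^esub> v \<oplus>\<^bsub>V\<^esub> HC q b \<odot>\<^bsub>V\<^esub> v = HC q (a + b) \<odot>\<^bsub>V\<^esub> v" for a b
    using ldistr [OF para_gens(1) para_gens(1) v, of a b] by (simp add: hcls_gens hcls_simps FC_add)
  have central: "HC q z \<otimes>\<^bsub>hecke q\<^esub> a = a \<otimes>\<^bsub>hecke q\<^esub> HC q z" if "a \<in> para q" for a z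
  proof -
    from para_rep [OF that] obtain y where "a = hcls q y" by blast
    then show ?thesis by (simp add: hcls_gens hcls_simps FC_commute)
  qed
  have gen_act: "a \<odot>\<^bsub>V\<^esub> (HC q z \<odot>\<^bsub>V\<^esub> v) = HC q (s * z) \<odot>\<^bsub>V\<^esub> v"
    if "a \<in> para q" "a \<odot>\<^bsub>V\<^esub> v = HC q s \<odot>\<^bsub>V\<^esub> v" for a s z
  proof -
    have "a \<odot>\<^bsub>V\<^esub> (HC q z \<odot>\<^bsub>V\<^esub> v) = HC q z \<odot>\<^bsub>V\<^esub> (a \<odot>\<^bsub>V\<^esub> v)"
      using assoc [OF that(1) para_gens(1) v] assoc [OF para_gens(1) that(1) v] central [OF that(1)]
      by simp
    then show ?thesis by (simp add: that HC_mult mult.commute)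
  qed
  have act_v: "a \<odot>\<^bsub>V\<^esub> v = HC q (chi a) \<odot>\<^bsub>V\<^esub> v" if "a \<in> para q" for a
    using that
  proof (induction rule: para_induct)
    case (add a b)
    then show ?case by (simp add: ldistr v HC_add chi_hom)
  next
    case (mult a b)
    then show ?case using gen_act [OF mult(1,3)] by (simp add: assoc v chi_hom)
  qed (simp_all add: chi_gens Tv Xv)
  have pure_zero_act: "act y cyc = 0" if "pure (hcls q y) v = \<zero>\<^bsub>M\<^esub>" for y
  proof -
    (* the balanced map that sends x and z v to z times x cyc *)
    define b where "b x w = \<phi> w *s rep x cyc" for x w
    have "b (hcls q y) v = 0"
    proof (rule pure_eq_zero_imp [OF _ _ _ in_H v that])
      fix x y w assume "x \<in> carrier (hecke q)" "y \<in> carrier (hecke q)"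
      then show "b (x \<oplus>\<^bsub>hecke q\<^esub> y) w = b x w + b y w"
        by (auto simp: b_def carrier_hecke hcls_simps word.lift_plus vec.scale_right_distrib)
    next
      fix x w w' assume "w \<in> carrier V" "w' \<in> carrier V"
      then obtain z z' where "w = HC q z \<odot>\<^bsub>V\<^esub> v" "w' = HC q z' \<odot>\<^bsub>V\<^esub> v" using V_cases by blast
      then show "b x (w \<oplus>\<^bsub>V\<^esub> w') = b x w + b x w'"
        by (simp add: b_def HC_add \<phi> vec.scale_left_distrib)
    next
      fix x a w assume x: "x \<in> carrier (hecke q)" and a: "a \<in> para q" and "w \<in> carrier V"
      then obtain z where w: "w = HC q z \<odot>\<^bsub>V\<^esub> v" using V_cases by blast
      obtain y y' where y: "x = hcls q y" "a = hcls q y'"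
        using x para_rep [OF a] by (auto simp: carrier_hecke)
      have "act y' cyc = chi a *s cyc" using chi [OF a] y by simp
      then have "rep (x \<otimes>\<^bsub>hecke q\<^esub> a) cyc = chi a *s rep x cyc"
        by (simp add: y(1) hcls_simps word.lift_mult word.lift_scale y(2) [symmetric])
          (simp add: y hcls_simps word.lift_mult word.lift_scale)
      moreover have "\<phi> (a \<odot>\<^bsub>V\<^esub> w) = chi a * z"
        unfolding w gen_act [OF a act_v [OF a]] by (rule \<phi>)
      ultimately show "b (x \<otimes>\<^bsub>hecke q\<^esub> a) w = b x (a \<odot>\<^bsub>V\<^esub> w)"
        by (simp add: b_def w \<phi> mult.commute)
    qed
    moreover have "HC q 1 \<odot>\<^bsub>V\<^esub> v = v"
      using V.smult_one [OF v] by (simp add: hcls_gens hcls_simps)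
    then have "\<phi> v = 1" using \<phi> [of 1] by simp
    ultimately show ?thesis by (simp add: b_def)
  qed
  interpret M: left_module "hecke q" M by (rule left_module_tensor)
  (* the annihilator of 1 (x) v in the free algebra *)
  define L where "L = {y. pure (hcls q y) v = \<zero>\<^bsub>M\<^esub>}"
  have pure_M: "pure (hcls q y) v \<in> carrier M" for y by (intro pure_closed v in_H)
  have L_plus: "pure (hcls q (x + y)) v = pure (hcls q x) v \<oplus>\<^bsub>M\<^esub> pure (hcls q y) v" for x y
    using pure_add [OF in_H in_H v, of x y] by (simp add: hcls_simps)
  have L_mult: "pure (hcls q (x * y)) v = hcls q x \<odot>\<^bsub>M\<^esub> pure (hcls q y) v" for x y
    using smult_pure [OF in_H in_H v, of x y] by (simp add: hcls_simps)
  have L_zero: "pure (hcls q 0) v = \<zero>\<^bsub>M\<^esub>"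
    using L_plus [of 0 0] pure_M [of 0] by (metis M.M.add.l_cancel_one M.M.zero_closed add.right_neutral)
  have L_ideal: "y \<in> L" if "y \<in> hecke_ideal q" for y
  proof -
    have "hcls q y = hcls q 0" using that by (simp add: hcls_eq_iff)
    then show ?thesis by (simp add: L_def L_zero)
  qed
  have L_diff: "x - y \<in> L \<longleftrightarrow> pure (hcls q x) v = pure (hcls q y) v" for x y
    using L_plus [of "x - y" y] pure_M [of y] pure_M [of "x - y"] by (auto simp: L_def)
  have L_add: "x + y \<in> L" if "x \<in> L" "y \<in> L" for x y
    using that by (simp add: L_def L_plus)
  have L_right: "x - FC s \<in> L" if "hcls q x \<in> para q" "chi (hcls q x) = s" for x s
  proof -
    have "pure (hcls q x) v = pure (hcls q (FC s)) v"
      using pure_balanced [OF in_H that(1) v, of 1] pure_balanced [OF in_H para_gens(1) v, of 1 s]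
        act_v [OF that(1)] that(2)
      by (simp add: hcls_gens hcls_simps)
    then show ?thesis by (simp add: L_diff)
  qed
  have \<kappa>: "p ^ 3 - inverse (p ^ 3) = \<kappa>"
    unfolding \<kappa>_def by (simp add: u_eq divide_inverse power_inverse)
  interpret L: cyclic_left_ideal \<kappa> q "wt (u\<^sup>2) (p ^ 6)" L
  proof
    fix x y a i f l
    show "x \<in> L \<Longrightarrow> y \<in> L \<Longrightarrow> x + y \<in> L" by (rule L_add)
    show "x \<in> L \<Longrightarrow> a * x \<in> L"
      using left_module_smult_zero [OF left_module_tensor in_H] by (simp add: L_def L_mult)
    show "(FT i * FT i - (FC \<kappa> * FT i + 1)) * y \<in> L"
      using rels_ideal [of "FT i * FT i - (FC \<kappa> * FT i + 1)" q 1 y]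
      by (intro L_ideal) (auto simp: hecke_rels_def \<kappa>)
    show "(FX l * FT i - (FT i * FX (srefl i l) + FC \<kappa> * FX_lin f)) * y \<in> L"
      if "f * (1 - eX (- sroot i)) = eX l - eX (srefl i l)"
    proof -
      have "FX l * FT i - (FT i * FX (srefl i l) + FC \<kappa> * FX_lin f) \<in> hecke_rels q"
        unfolding hecke_rels_def \<kappa> using that by blast
      from rels_ideal [OF this, of 1 y] show ?thesis by (intro L_ideal) simp
    qed
    show gen_T: "FT N2 - FC q \<in> L"
      using para_gens(2) chi_gens(2) by (intro L_right) (simp_all add: hcls_gens)
    show "FX l - FC (wt (u\<^sup>2) (p ^ 6) l) \<in> L"
      using para_gens(3) chi_gens(3) by (intro L_right) (simp_all add: hcls_gens)
    show "(FT N2 - FC q) * Tw 5 \<in> L"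
    proof -
      (* By the braid relation T_2 Tw 5 equals Tw 5 T_2, and T_2 acts on v by q. *)
      define b where "b = FT N1 * FT N2 * FT N1 * FT N2 * FT N1 * FT N2 - FT N2 * FT N1 * FT N2 * FT N1 * FT N2 * FT N1"
      have "Tw 5 * (FT N2 - FC q) \<in> L"
        using left_module_smult_zero [OF left_module_tensor in_H] gen_T by (simp add: L_def L_mult)
      moreover have "(-1) * b * 1 \<in> L"
        by (intro L_ideal rels_ideal) (simp add: hecke_rels_def b_def)
      ultimately have "(-1) * b * 1 + Tw 5 * (FT N2 - FC q) \<in> L"
        by (intro L_add)
      moreover have "(-1) * b * 1 + Tw 5 * (FT N2 - FC q) = (FT N2 - FC q) * Tw 5"
        by (simp add: b_def eval_nat_numeral algebra_simps FC_commute)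
      ultimately show ?thesis by simp
    qed
  qed
  have L_eq: "y \<in> L \<longleftrightarrow> act y cyc = 0" for y
  proof
    assume "act y cyc = 0"
    obtain c where c: "y - normal_form c \<in> L" using L.congruent_normal_form by blast
    then have "act (y - normal_form c) cyc = 0" using pure_zero_act by (simp add: L_def)
    with \<open>act y cyc = 0\<close> have "orbit c = orbit 0"
      by (simp add: orbit_def word.lift_diff normal_form_def)
    then have "c = 0" using orbit_inj by (simp add: inj_eq)
    with c show "y \<in> L" by (simp add: normal_form_def)
  qed (use pure_zero_act in \<open>simp add: L_def\<close>)
  have M_cases: "\<exists>y. C = pure (hcls q y) v" if "C \<in> carrier M" for C
  proof -
    have "\<exists>x\<in>carrier (hecke q). C = pure x v"
    proof (rule pure_cases [OF v _ that])
      fix w assume "w \<in> carrier V"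
      then obtain z where "w = HC q z \<odot>\<^bsub>V\<^esub> v" using V_cases by blast
      then show "\<exists>a\<in>para q. w = a \<odot>\<^bsub>V\<^esub> v" using para_gens(1) by blast
    qed
    then show ?thesis by (auto simp: carrier_hecke)
  qed
  show ?thesis
    unfolding irreducible_module_def ind
  proof (intro conjI allI impI)
    show "left_module (hecke q) M" by (rule left_module_tensor)
    have "1 \<notin> L" using cyc_nonzero by (simp add: L_eq)
    then show "carrier M \<noteq> {\<zero>\<^bsub>M\<^esub>}" using pure_M [of 1] by (auto simp: L_def)
  next
    fix U assume U: "submodule U (hecke q) M"
    then interpret U: submodule U "hecke q" M .
    show "U = {\<zero>\<^bsub>M\<^esub>} \<or> U = carrier M"
    proof (cases "U = {\<zero>\<^bsub>M\<^esub>}")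
      case False
      have "\<zero>\<^bsub>M\<^esub> \<in> U" using U.one_closed by simp
      with False obtain C where C: "C \<in> U" "C \<noteq> \<zero>\<^bsub>M\<^esub>" by blast
      have U_M: "U \<subseteq> carrier M" using U.subset by simp
      then obtain y where y: "C = pure (hcls q y) v" using C(1) M_cases by blast
      with C(2) have "act y cyc \<noteq> 0" using L_eq by (simp add: L_def)
      then obtain z where "act z (act y cyc) = cyc" using act_surj by blast
      then have "z * y - 1 \<in> L" by (simp add: L_eq word.lift_diff word.lift_mult)
      then have "pure (hcls q 1) v = hcls q z \<odot>\<^bsub>M\<^esub> C" by (simp add: L_diff L_mult y)
      then have 1: "pure (hcls q 1) v \<in> U" using U.smult_closed [OF in_H C(1)] by simp
      have "carrier M \<subseteq> U"
      proof
        fix C assume "C \<in> carrier M"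
        then obtain y where "C = pure (hcls q (y * 1)) v" using M_cases by (metis mult.right_neutral)
        then show "C \<in> U" using U.smult_closed [OF in_H 1] by (simp only: L_mult)
      qed
      with U_M show ?thesis by blast
    qed simp
  qed
qed

end

text \<open>The defining relations depend on \<open>q\<close> only through \<open>q - q\<^bsup>-1\<^esup>\<close>.\<close>

lemma neg_inverse:
  "hecke (- inverse q) = hecke q" "induced (- inverse q) i = induced q i"
  "line_module (- inverse q) i = line_module q i"
proof -
  have "hecke_rels (- inverse q) = hecke_rels q"
    by (simp add: hecke_rels_def)
  then have ideal: "hecke_ideal (- inverse q) = hecke_ideal q"
    by (simp add: hecke_ideal_def)
  then show hecke: "hecke (- inverse q) = hecke q"
    by (simp add: hecke_def)
  have gens: "HC (- inverse q) = HC q" "HT (- inverse q) = HT q" "HX (- inverse q) = HX q"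
    using ideal by (simp_all add: fun_eq_iff HC_def HT_def HX_def)
  have sub: "hecke_sub (- inverse q) i = hecke_sub q i"
    by (simp only: hecke_sub_def hecke gens)
  show "induced (- inverse q) i = induced q i"
    by (intro ext) (simp only: induced_def hecke sub)
  show "line_module (- inverse q) i = line_module q i"
    by (intro ext) (simp only: line_module_def gens sub)
qed

lemma inv_w0: "inv_into UNIV w0 = w0"
  by (rule Hilbert_Choice.inv_equality) (simp_all add: w0_eq_uminus)

theorem proposition32:
  fixes q r :: complex and t t' :: "lattice \<Rightarrow> complex"
  assumes "q \<noteq> 0" and "r \<noteq> 0"
    and "q ^ 2 \<noteq> 1" and "q ^ 2 \<noteq> - 1"
    and "r ^ 3 = q ^ 2"
    and "r \<noteq> q ^ 2" and "r \<noteq> inverse (q ^ 2)"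
    and "r \<noteq> q" and "r \<noteq> - q" and "r \<noteq> inverse q" and "r \<noteq> - inverse q"
    and "t = wt r 1"
    and "t' = weight_act (srefl N1) t"
  shows "(\<exists>(V :: (hecke_elt, complex) module) v. line_module q N2 q t' V v) \<and>
    (\<exists>(V :: (hecke_elt, complex) module) v.
       line_module q N2 (- inverse q) (weight_act w0 t') V v) \<and>
    (\<forall>(V :: (hecke_elt, 'v) module) v.
       line_module q N2 q t' V v \<longrightarrow>
       irreducible_module (hecke q) (induced q N2 V)) \<and>
    (\<forall>(V :: (hecke_elt, 'v) module) v.
       line_module q N2 (- inverse q) (weight_act w0 t') V v \<longrightarrow>
       irreducible_module (hecke q) (induced q N2 V))"
proof -
  (* p is a square root of r and a cube root of q at the same time. *)
  define p u where "p = q / r" and "u = r / q"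
  have pu: "p * u = 1" using assms(1,2) by (simp add: p_def u_def)
  have p2: "p\<^sup>2 = r"
  proof -
    have "p\<^sup>2 = r ^ 3 / r\<^sup>2" unfolding assms(5) by (simp add: p_def power_divide)
    then show ?thesis using assms(2) by (simp add: field_simps power2_eq_square power3_eq_cube)
  qed
  have q: "q = p ^ 3"
  proof -
    have "p ^ 3 = p\<^sup>2 * p" by (simp add: power2_eq_square power3_eq_cube)
    then show ?thesis unfolding p2 using assms(2) by (simp add: p_def)
  qed
  have u2: "u\<^sup>2 = inverse r"
    using pu p2 assms(2) by (simp add: u_def p_def power_divide field_simps)
  have G: "generic_weight_parameter p u"
  proof
    show "p * u = 1" by (rule pu)
    show "p ^ 4 \<noteq> 1"
    proof
      assume "p ^ 4 = 1"
      then have "p\<^sup>2 = q\<^sup>2" unfolding q power_mult [symmetric]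
        using power_add [of p 4 2] by simp
      with p2 assms(6) show False by simp
    qed
    show "p ^ 6 \<noteq> 1" "p ^ 6 \<noteq> - 1"
      using assms(3,4) unfolding q power_mult [symmetric] by simp_all
    show "p ^ 8 \<noteq> 1"
    proof
      assume "p ^ 8 = 1"
      moreover have "p ^ 8 = r * q\<^sup>2" unfolding p2 [symmetric] q power_mult [symmetric]
        using power_add [of p 2 6] by simp
      ultimately show False using assms(1,7) by (simp add: field_simps)
    qed
    show "p ^ 10 \<noteq> 1"
    proof
      assume "p ^ 10 = 1"
      moreover have "p ^ 10 = (r * q)\<^sup>2" unfolding p2 [symmetric] q
        by (simp flip: power_add power_mult)
      ultimately have "r * q = 1 \<or> r * q = - 1" by (simp add: power2_eq_1_iff)
      then show False using assms(1,10,11) by (auto simp: field_simps)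
    qed
  qed
  interpret generic_weight_parameter p u by (rule G)
  (* For (- inverse q, inverse r) the quotient q / r becomes - r / q = - u. *)
  have G': "generic_weight_parameter (- u) (- p)"
  proof
    show "- u * - p = 1" using pu by (simp add: mult.commute)
    show "(- u) ^ 4 \<noteq> 1" using p4 by (simp add: u_eq power_divide p0)
    show "(- u) ^ 6 \<noteq> 1" "(- u) ^ 8 \<noteq> 1" "(- u) ^ 10 \<noteq> 1"
      using p6 p8 p10 by (simp_all add: u_eq power_divide p0)
    show "(- u) ^ 6 \<noteq> - 1"
      using p6 p0 by (simp add: u_eq power_divide divide_eq_eq) (metis minus_equation_iff)
  qed
  have nq: "- inverse q = (- u) ^ 3"
    by (simp add: q u_eq divide_inverse power_inverse)
  have t': "t' = wt (u\<^sup>2) (p ^ 6)"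
  proof
    fix l :: lattice
    obtain a b where l: "l = (a, b)" by (cases l)
    have "t' l = r powi (3 * b - a)"
      by (simp add: assms(12,13) weight_act_def srefl_def wt_def l)
    also have "\<dots> = r powi (3 * b) / r powi a"
      using assms(2) by (simp add: power_int_diff)
    also have "\<dots> = wt (u\<^sup>2) (r ^ 3) l"
      by (simp add: wt_def u2 l power_int_inverse power_int_power divide_inverse)
    also have "r ^ 3 = p ^ 6"
      unfolding p2 [symmetric] by simp
    finally show "t' l = wt (u\<^sup>2) (p ^ 6) l" .
  qed
  have w0t': "weight_act w0 t' = wt ((- p)\<^sup>2) ((- u) ^ 6)"
  proof
    fix l :: lattice
    have u: "u\<^sup>2 = inverse (p\<^sup>2)" "(- u) ^ 6 = inverse (p ^ 6)"
      by (simp_all add: u_eq divide_inverse power_inverse)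
    show "weight_act w0 t' l = wt ((- p)\<^sup>2) ((- u) ^ 6) l"
      unfolding t' weight_act_def inv_w0 w0_eq_uminus wt_def u
      by (simp only: fst_uminus snd_uminus power_int_minus power_int_inverse
          inverse_inverse_eq power2_minus)
  qed
  note M = generic_weight_parameter.line_module_exists [OF G, folded q]
    generic_weight_parameter.induced_irreducible [OF G, folded q]
  note N = generic_weight_parameter.line_module_exists [OF G', folded nq]
    generic_weight_parameter.induced_irreducible [OF G', folded nq]
  show ?thesis
    using M N unfolding neg_inverse t' w0t' [unfolded t'] by blast
qed

end
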